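(* Let $p$ be a prime and $G=\mathrm{PSL}(2,p)$, and suppose $m(G)=4$. Then $G$ satisfies the replacement property.
   Context: A generating sequence $(g_1,\dots,g_k)$ of a finite group $G$ is irredundant if, for every $j$, removing $g_j$ leaves a sequence that does not generate $G$; $m(G)$ is the maximum length of an irredundant generating sequence of $G$. $G$ satisfies the replacement property for the generating sequence $s=(g_1,\dots,g_k)$ if for every non-identity $g\in G$ there exists an $i$ such that $(g_1,\dots,g_{i-1},g,g_{i+1},\dots,g_k)$ generates $G$. $G$ satisfies the replacement property if it satisfies it for all irredundant generating sequences of length $m(G)$. *)

theory Defs
  imports
    "HOL-Analysis.Determinants"
    "HOL-Algebra.Generated_Groups"
    "HOL-Computational_Algebra.Primes"
begin

section \<open>Generating sequences of a group\<close>

definition generating_seq :: "('g, 'b) monoid_scheme \<Rightarrow> 'g list \<Rightarrow> bool" where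
  "generating_seq G s \<longleftrightarrow> set s \<subseteq> carrier G \<and> generate G (set s) = carrier G"

definition remove_nth :: "nat \<Rightarrow> 'g list \<Rightarrow> 'g list" where
  "remove_nth j s = take j s @ drop (Suc j) s"

definition irredundant_generating_seq :: "('g, 'b) monoid_scheme \<Rightarrow> 'g list \<Rightarrow> bool" where
  "irredundant_generating_seq G s \<longleftrightarrow>
     generating_seq G s \<and> (\<forall>j<length s. \<not> generating_seq G (remove_nth j s))"

text \<open>For a finite group the set below is finite and nonempty
  (see \<open>finite_irredundant_lengths\<close> and \<open>irredundant_lengths_nonempty\<close>),
  so the maximum is attained.\<close>

definition max_irredundant_length :: "('g, 'b) monoid_scheme \<Rightarrow> nat" where
  "max_irredundant_length G = Max {length s | s. irredundant_generating_seq G s}"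

definition replacement_property_for :: "('g, 'b) monoid_scheme \<Rightarrow> 'g list \<Rightarrow> bool" where
  "replacement_property_for G s \<longleftrightarrow>
     (\<forall>g\<in>carrier G. g \<noteq> \<one>\<^bsub>G\<^esub> \<longrightarrow> (\<exists>i<length s. generating_seq G (s[i := g])))"

definition replacement_property :: "('g, 'b) monoid_scheme \<Rightarrow> bool" where
  "replacement_property G \<longleftrightarrow>
     (\<forall>s. irredundant_generating_seq G s \<and> length s = max_irredundant_length G
        \<longrightarrow> replacement_property_for G s)"

lemma irredundant_generating_seq_distinct:
  assumes "irredundant_generating_seq G s"
  shows "distinct s"
proof (rule ccontr)
  assume "\<not> distinct s"
  then obtain i j where ij: "i < j" "j < length s" "s ! i = s ! j"
    by (metis distinct_conv_nth linorder_neqE_nat)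
  have "s ! i \<in> set (take j s)"
    using ij by (metis in_set_conv_nth length_take min.absorb4 nth_take)
  moreover have "set s = insert (s ! j) (set (remove_nth j s))"
    using arg_cong[OF id_take_nth_drop[OF ij(2)], of set] by (simp add: remove_nth_def)
  ultimately have "set (remove_nth j s) = set s"
    using ij(3) by (auto simp: remove_nth_def)
  then show False
    using assms ij(2) unfolding irredundant_generating_seq_def generating_seq_def by metis
qed

lemma finite_irredundant_lengths:
  assumes "finite (carrier G)"
  shows "finite {length s | s. irredundant_generating_seq G s}"
proof (rule finite_subset)
  show "{length s | s. irredundant_generating_seq G s} \<subseteq> {..card (carrier G)}"
  proof clarsimp
    fix s assume s: "irredundant_generating_seq G s"
    then have "set s \<subseteq> carrier G"
      by (simp add: irredundant_generating_seq_def generating_seq_def)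
    with assms show "length s \<le> card (carrier G)"
      using card_mono distinct_card[OF irredundant_generating_seq_distinct[OF s]] by metis
  qed
qed simp

lemma irredundant_lengths_nonempty:
  assumes "group G" and "finite (carrier G)"
  shows "{length s | s. irredundant_generating_seq G s} \<noteq> {}"
proof -
  obtain xs where "set xs = carrier G"
    using finite_list[OF assms(2)] by blast
  moreover have "generate G (carrier G) = carrier G"
    using group.generate_incl[OF assms(1) subset_refl] by (auto intro: generate.incl)
  ultimately have "generating_seq G xs"
    by (simp add: generating_seq_def)
  then obtain s where s: "generating_seq G s"
      and min: "\<And>t. generating_seq G t \<Longrightarrow> length s \<le> length t"
    using that ex_has_least_nat[of "generating_seq G" xs length] by blast
  have "\<not> generating_seq G (remove_nth j s)" if "j < length s" for j
    using min[of "remove_nth j s"] that by (force simp: remove_nth_def)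
  with s show ?thesis
    by (auto simp: irredundant_generating_seq_def)
qed

section \<open>The groups SL(2) and PSL(2) of a field\<close>

text \<open>The ground field is the element type. A field type with a prime number \<open>p\<close> of
  elements is (a copy of) the field of integers modulo \<open>p\<close>, so that over such a type
  \<open>PSL2\<close> is \<open>PSL(2,p)\<close>; its elements are the cosets of \<open>{1, -1}\<close>.\<close>

definition SL2 :: "('a::field ^ 2 ^ 2) monoid" where
  "SL2 = \<lparr>carrier = {A. det A = 1}, mult = (**), one = mat 1\<rparr>"

definition PSL2 :: "('a::field ^ 2 ^ 2) set monoid" where
  "PSL2 = SL2 Mod {mat 1, - mat 1}"

lemma group_SL2: "group (SL2 :: ('a::field ^ 2 ^ 2) monoid)"
proof (rule groupI)
  fix A :: "'a ^ 2 ^ 2"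
  assume "A \<in> carrier SL2"
  then have dA: "det A = 1" by (simp add: SL2_def)
  then obtain B where B: "A ** B = mat 1" "B ** A = mat 1"
    using invertible_det_nz[of A] by (auto simp: invertible_def)
  then have "det B = 1"
    using det_mul[of A B] dA by simp
  with B show "\<exists>B\<in>carrier SL2. B \<otimes>\<^bsub>SL2\<^esub> A = \<one>\<^bsub>SL2\<^esub>"
    by (auto simp: SL2_def)
qed (auto simp: SL2_def det_mul matrix_mul_assoc)

lemma minus_mat_1_mult:
  fixes A :: "'a::field ^ 2 ^ 2"
  shows "(- mat 1) ** A = - A" and "A ** (- mat 1) = - A"
  by (simp_all add: vec_eq_iff matrix_matrix_mult_def mat_def sum_2 forall_2)

lemma normal_SL2: "{mat 1, - mat 1} \<lhd> (SL2 :: ('a::field ^ 2 ^ 2) monoid)"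
proof -
  interpret group "SL2 :: ('a ^ 2 ^ 2) monoid" by (rule group_SL2)
  have d: "det (- mat 1 :: 'a ^ 2 ^ 2) = 1"
    by (simp add: det_2 mat_def)
  have sg: "subgroup {mat 1, - mat 1} (SL2 :: ('a ^ 2 ^ 2) monoid)"
  proof (rule subgroupI)
    fix A assume A: "A \<in> {mat 1, - mat 1 :: 'a ^ 2 ^ 2}"
    have "A \<otimes>\<^bsub>SL2\<^esub> A = \<one>\<^bsub>SL2\<^esub>" "A \<in> carrier SL2"
      using A d by (auto simp: SL2_def minus_mat_1_mult)
    then show "inv\<^bsub>SL2\<^esub> A \<in> {mat 1, - mat 1}"
      using A inv_equality by metis
  qed (use d in \<open>auto simp: SL2_def minus_mat_1_mult\<close>)
  show ?thesis
  proof (rule normalI[OF sg], intro ballI)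
    fix A :: "'a ^ 2 ^ 2"
    show "{mat 1, - mat 1} #>\<^bsub>SL2\<^esub> A = A <#\<^bsub>SL2\<^esub> {mat 1, - mat 1}"
      by (simp add: r_coset_def l_coset_def SL2_def minus_mat_1_mult)
  qed
qed

lemma group_PSL2: "group (PSL2 :: ('a::field ^ 2 ^ 2) set monoid)"
  unfolding PSL2_def by (rule normal.factorgroup_is_group[OF normal_SL2])

end

theory Submission
  imports Defs "HOL-Algebra.Multiplicative_Group" "HOL-Number_Theory.Residues"
begin

text \<open>Suppose that replacing any entry of \<open>(g\<^sub>1, \<dots>, g\<^sub>4)\<close> by \<open>g \<noteq> 1\<close> fails to generate. Then the
  subgroups \<open>K\<^sub>i\<close> generated by \<open>g\<close> and the \<open>g\<^sub>j\<close> with \<open>j \<noteq> i\<close> are proper. For odd \<open>p\<close> let \<open>SL(2,p)\<close> act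
  by conjugation on the three-dimensional space of trace-free matrices. A line fixed by \<open>g\<close> is the axis
  of \<open>g\<close> or orthogonal to it, hence an element fixing two distinct lines fixed by \<open>g\<close> fixes the axis.
  So, as soon as at least three generators are added to \<open>g\<close> and every group obtained by omitting
  one of them fixes a line, all of them fix a common line. Since \<open>SL(2,p)\<close> fixes no line, some
  \<open>K\<^sub>i\<close> fixes none, and then neither does a subgroup \<open>H\<close> of \<open>K\<^sub>i\<close> obtained by omitting
  a suitable second generator. A proper subgroup without fixed line contains no transvection, and
  counting its elements torus by torus shows that its preimage in \<open>SL(2,p)\<close> has order 24, 48 or 120.
  As \<open>H\<close> is a proper subgroup of \<open>K\<^sub>i\<close>, its preimage has order 24; but \<open>H\<close> has two incomparable
  subgroups containing \<open>g\<close>, which is impossible in the alternating group of degree 4.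
  For \<open>p = 2\<close> a chain of subgroups obtained by omitting generators is too long for the group.\<close>

section \<open>Groups in which commuting is transitive off the centre\<close>

text \<open>This is the classical equation for the rotation groups of the tetrahedron, octahedron
  and icosahedron, written with the order \<open>g\<close> of the double cover. The bound
  \<open>8 * real m \<le> g\<close> removes the dihedral solutions \<open>k = l = 2\<close>, for
  which \<open>g = 4 * m\<close>. Otherwise the excess over 1 forces \<open>k = 2\<close>,
  \<open>l = 3\<close> and \<open>m < 6\<close>.\<close>

lemma unit_fraction_sum_sorted:
  fixes k l m :: nat and g :: real
  assumes "2 \<le> k" "k \<le> l" "l \<le> m" "8 * real m \<le> g"
    and sum: "1 / k + 1 / l + 1 / m = 1 + 4 / g"
  shows "k = 2 \<and> l = 3 \<and> (m = 3 \<and> g = 24 \<or> m = 4 \<and> g = 48 \<or> m = 5 \<and> g = 120)"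
proof -
  have "g > 0"
    using assms(1-4) by linarith
  then have pos: "4 / g > 0"
    by simp
  have inv_le: "1 / real j \<le> 1 / real i" if "0 < i" "i \<le> j" for i j :: nat
    using that by (simp add: frac_le)
  have "k = 2"
  proof (rule ccontr)
    assume "k \<noteq> 2"
    then have "1 / k \<le> 1 / 3" "1 / l \<le> 1 / 3" "1 / m \<le> 1 / 3"
      using assms(1-3) inv_le[of 3 k] inv_le[of 3 l] inv_le[of 3 m] by auto
    with sum pos show False
      by linarith
  qed
  then have sum2: "1 / l + 1 / m = 1 / 2 + 4 / g"
    using sum by simp
  have "l \<noteq> 2"
  proof
    assume "l = 2"
    with sum2 have "1 / m = 4 / g"
      by simp
    then have "g = 4 * real m"
      using \<open>g > 0\<close> assms(1-3) by (simp add: field_simps)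
    with assms(1-4) show False
      by linarith
  qed
  moreover have "l < 4"
  proof (rule ccontr)
    assume "\<not> l < 4"
    then have "1 / l \<le> 1 / 4" "1 / m \<le> 1 / 4"
      using assms(3) inv_le[of 4 l] inv_le[of 4 m] by auto
    with sum2 pos show False
      by linarith
  qed
  ultimately have "l = 3"
    using \<open>k = 2\<close> assms(2) by linarith
  with sum2 have sum3: "1 / m = 1 / 6 + 4 / g"
    by simp
  have "m < 6"
  proof (rule ccontr)
    assume "\<not> m < 6"
    then have "1 / m \<le> 1 / 6"
      using inv_le[of 6 m] by auto
    with sum3 pos show False
      by linarith
  qed
  then have "m = 3 \<or> m = 4 \<or> m = 5"
    using \<open>l = 3\<close> assms(3) by auto
  with sum3 \<open>g > 0\<close> \<open>k = 2\<close> \<open>l = 3\<close> show ?thesis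
    by (auto simp: field_simps)
qed

lemma unit_fraction_sum:
  fixes k l m :: nat and g :: real
  assumes "2 \<le> k" "2 \<le> l" "2 \<le> m" "8 * real k \<le> g" "8 * real l \<le> g" "8 * real m \<le> g"
    and sum: "1 / k + 1 / l + 1 / m = 1 + 4 / g"
  shows "g \<in> {24, 48, 120}"
    and "g = 24 \<Longrightarrow> k = 3 \<and> l = 3 \<or> k = 3 \<and> m = 3 \<or> l = 3 \<and> m = 3"
proof -
  have *: "g \<in> {24, 48, 120} \<and> (g = 24 \<longrightarrow> k = 3 \<and> l = 3 \<or> k = 3 \<and> m = 3 \<or> l = 3 \<and> m = 3)"
  proof -
    consider "k \<le> l" "l \<le> m" | "k \<le> m" "m \<le> l" | "l \<le> k" "k \<le> m"
      | "l \<le> m" "m \<le> k" | "m \<le> k" "k \<le> l" | "m \<le> l" "l \<le> k"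
      by linarith
    then show ?thesis
    proof cases
      case 1 then show ?thesis
        using unit_fraction_sum_sorted[of k l m g] assms by auto
    next
      case 2 then show ?thesis
        using unit_fraction_sum_sorted[of k m l g] assms by (auto simp: add_ac)
    next
      case 3 then show ?thesis
        using unit_fraction_sum_sorted[of l k m g] assms by (auto simp: add_ac)
    next
      case 4 then show ?thesis
        using unit_fraction_sum_sorted[of l m k g] assms by (auto simp: add_ac)
    next
      case 5 then show ?thesis
        using unit_fraction_sum_sorted[of m k l g] assms by (auto simp: add_ac)
    next
      case 6 then show ?thesis
        using unit_fraction_sum_sorted[of m l k g] assms by (auto simp: add_ac)
    qed
  qed
  from * show "g \<in> {24, 48, 120}" by blast
  from * show "g = 24 \<Longrightarrow> k = 3 \<and> l = 3 \<or> k = 3 \<and> m = 3 \<or> l = 3 \<and> m = 3" by blast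
qed

text \<open>Here one torus is its own normalizer and contributes \<open>1 / k\<close>, while another
  has index 2 in its normalizer and contributes \<open>1 / (2 * real l)\<close>. The bound on
  \<open>g\<close> excludes \<open>k = 2\<close>, where \<open>g = 4 * l\<close>; the excess over
  1/2 then leaves only \<open>k = 3\<close> and \<open>l = 2\<close>.\<close>

lemma unit_fraction_sum_two:
  fixes k l :: nat and g :: real
  assumes "2 \<le> k" "2 \<le> l" "8 * real l \<le> g"
    and sum: "1 / k + 1 / (2 * real l) = 1 / 2 + 2 / g"
  shows "k = 3" "g = 24"
proof -
  have "g > 0"
    using assms(2,3) by linarith
  then have pos: "2 / g > 0"
    by simp
  have inv_le: "1 / real j \<le> 1 / real i" if "0 < i" "i \<le> j" for i j :: nat
    using that by (simp add: frac_le)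
  have l: "1 / (2 * real l) \<le> 1 / 4"
    using inv_le[of 2 l] assms(2) by simp
  have "k \<noteq> 2"
  proof
    assume "k = 2"
    with sum have "1 / (2 * real l) = 2 / g"
      by simp
    then have "g = 4 * real l"
      using \<open>g > 0\<close> assms(2) by (simp add: field_simps)
    with assms(2,3) show False
      by linarith
  qed
  moreover have "k < 4"
  proof (rule ccontr)
    assume "\<not> k < 4"
    then have "1 / k \<le> 1 / 4"
      using inv_le[of 4 k] by auto
    with sum l pos show False
      by linarith
  qed
  ultimately show "k = 3"
    using assms(1) by linarith
  with sum have sum3: "1 / (2 * real l) = 1 / 6 + 2 / g"
    by simp
  have "l < 3"
  proof (rule ccontr)
    assume "\<not> l < 3"
    then have "1 / (2 * real l) \<le> 1 / 6"
      using inv_le[of 3 l] by auto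
    with sum3 pos show False
      by linarith
  qed
  then have "l = 2"
    using assms(2) by linarith
  with sum3 \<open>g > 0\<close> show "g = 24"
    by (simp add: field_simps)
qed

section \<open>Orders of nested subgroups\<close>

lemma (in group) card_subgroup_dvd:
  assumes "subgroup H G" "subgroup K G" "H \<subseteq> K"
  shows "card H dvd card K"
proof -
  have "subgroup H (G\<lparr>carrier := K\<rparr>)"
    using assms by (simp add: subgroup_incl)
  then show ?thesis
    using group.lagrange[OF subgroup_imp_group[OF assms(2)]]
    by (metis dvd_triv_right order_def partial_object.simps(1) partial_object.update_convs(1) partial_object.surjective monoid.select_convs(1))
qed

lemma (in group) double_card_subgroup_le:
  assumes "finite (carrier G)" and "subgroup H G" "subgroup K G" "H \<subset> K"
  shows "2 * card H \<le> card K"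
proof -
  obtain q where q: "card K = card H * q"
    using card_subgroup_dvd[of H K] assms by blast
  have "card H < card K"
    using assms(1,3,4) finite_subset[OF subgroup.subset[OF assms(3)]] by (simp add: psubset_card_mono)
  with q have "q \<noteq> 0" "q \<noteq> 1"
    by auto
  then have "2 \<le> q"
    by linarith
  then show ?thesis
    by (simp add: q mult.commute)
qed

section \<open>Tori and their normalizers\<close>

text \<open>The axioms isolate what the count uses about a subgroup of \<open>SL(2,p)\<close>,
  \<open>p\<close> odd, that contains \<open>- mat 1\<close> but no transvection; there
  \<open>z\<close> is \<open>- mat 1\<close>. The last axiom reflects that conjugate elements have
  equal traces, so the only conjugates of \<open>a\<close> in its own torus are \<open>a\<close> and
  possibly \<open>inv a\<close>.\<close>

locale commuting_transitive_group = group G for G (structure) +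
  fixes z
  assumes finite_carrier: "finite (carrier G)"
    and z_closed: "z \<in> carrier G"
    and z_neq_one: "z \<noteq> \<one>"
    and z_square: "z \<otimes> z = \<one>"
    and z_central: "x \<in> carrier G \<Longrightarrow> z \<otimes> x = x \<otimes> z"
    and square_eq_one: "x \<in> carrier G \<Longrightarrow> x \<otimes> x = \<one> \<Longrightarrow> x \<in> {\<one>, z}"
    and commute_trans: "\<lbrakk>a \<in> carrier G - {\<one>, z}; b \<in> carrier G - {\<one>, z}; c \<in> carrier G - {\<one>, z};
      a \<otimes> b = b \<otimes> a; b \<otimes> c = c \<otimes> b\<rbrakk> \<Longrightarrow> a \<otimes> c = c \<otimes> a"
    and conj_commute: "\<lbrakk>a \<in> carrier G - {\<one>, z}; x \<in> carrier G;
      (x \<otimes> a \<otimes> inv x) \<otimes> a = a \<otimes> (x \<otimes> a \<otimes> inv x)\<rbrakk> \<Longrightarrow> x \<otimes> a \<otimes> inv x \<in> {a, inv a}"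
begin

definition cj :: "'a \<Rightarrow> 'a \<Rightarrow> 'a" where
  "cj x a = x \<otimes> a \<otimes> inv x"

abbreviation com :: "'a \<Rightarrow> 'a \<Rightarrow> bool" where
  "com a b \<equiv> a \<otimes> b = b \<otimes> a"

abbreviation noncentral :: "'a set" where
  "noncentral \<equiv> carrier G - {\<one>, z}"

definition cent :: "'a \<Rightarrow> 'a set" where
  "cent a = {x \<in> carrier G. com x a}"

text \<open>In \<open>SL(2)\<close> the centralizers of noncentral elements are tori, and by commuting transitivity
  the set below is the normalizer of the torus of \<open>a\<close>. Every noncentral element lies in exactly
  one torus; \<open>torus_class a\<close> collects the elements of the conjugates of the torus of \<open>a\<close>.\<close>

definition line_stab :: "'a \<Rightarrow> 'a set" where
  "line_stab a = {x \<in> carrier G. com (cj x a) a}"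

definition torus_class :: "'a \<Rightarrow> 'a set" where
  "torus_class a = {b \<in> noncentral. \<exists>x\<in>carrier G. com (cj x a) b}"

lemma cj_closed [simp]: "\<lbrakk>x \<in> carrier G; a \<in> carrier G\<rbrakk> \<Longrightarrow> cj x a \<in> carrier G"
  by (simp add: cj_def)

lemma cj_cj: "\<lbrakk>x \<in> carrier G; y \<in> carrier G; a \<in> carrier G\<rbrakk> \<Longrightarrow> cj x (cj y a) = cj (x \<otimes> y) a"
  by (simp add: cj_def inv_mult_group m_assoc)

lemma cj_one [simp]: "a \<in> carrier G \<Longrightarrow> cj \<one> a = a"
  by (simp add: cj_def)

lemma cj_inv_cancel [simp]:
  assumes "x \<in> carrier G" "a \<in> carrier G"
  shows "cj (inv x) (cj x a) = a" "cj x (cj (inv x) a) = a"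
  using assms by (simp_all add: cj_cj)

lemma cj_mult: "\<lbrakk>x \<in> carrier G; a \<in> carrier G; b \<in> carrier G\<rbrakk> \<Longrightarrow> cj x (a \<otimes> b) = cj x a \<otimes> cj x b"
  by (simp add: cj_def m_assoc inv_solve_left)

lemma cj_inv: "\<lbrakk>x \<in> carrier G; a \<in> carrier G\<rbrakk> \<Longrightarrow> cj x (inv a) = inv (cj x a)"
  by (simp add: cj_def inv_mult_group m_assoc)

lemma cj_inj: "\<lbrakk>x \<in> carrier G; a \<in> carrier G; b \<in> carrier G; cj x a = cj x b\<rbrakk> \<Longrightarrow> a = b"
  by (simp add: cj_def)

lemma cj_central: "\<lbrakk>x \<in> carrier G; a \<in> {\<one>, z}\<rbrakk> \<Longrightarrow> cj x a = a"
  using z_closed z_central[of x] by (auto simp: cj_def inv_solve_right')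

lemma cj_noncentral: "\<lbrakk>x \<in> carrier G; a \<in> noncentral\<rbrakk> \<Longrightarrow> cj x a \<in> noncentral"
  using cj_central[of "inv x" "cj x a"] by (auto simp: cj_cj)

lemma com_cj: "\<lbrakk>x \<in> carrier G; a \<in> carrier G; b \<in> carrier G\<rbrakk> \<Longrightarrow> com (cj x a) (cj x b) \<longleftrightarrow> com a b"
  by (metis cj_inj cj_mult m_closed)

lemma cj_fixed_iff: "\<lbrakk>x \<in> carrier G; a \<in> carrier G\<rbrakk> \<Longrightarrow> cj x a = a \<longleftrightarrow> com x a"
  by (metis cj_def inv_closed inv_solve_right' m_closed)

lemma subgroup_cent: "a \<in> carrier G \<Longrightarrow> subgroup (cent a) G"
proof (rule subgroupI)
  assume a: "a \<in> carrier G"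
  show "cent a \<noteq> {}"
    using a by (auto simp: cent_def intro: exI[of _ \<one>])
  show "inv x \<in> cent a" if "x \<in> cent a" for x
  proof -
    have "x \<in> carrier G" "cj x a = a"
      using that a cj_fixed_iff[of x a] by (auto simp: cent_def)
    then have "cj (inv x) a = a"
      using a cj_inv_cancel(1) by metis
    then show ?thesis
      using a \<open>x \<in> carrier G\<close> cj_fixed_iff[of "inv x" a] by (simp add: cent_def)
  qed
  show "x \<otimes> y \<in> cent a" if "x \<in> cent a" "y \<in> cent a" for x y
    using that a cj_cj[of x y a] cj_fixed_iff[of x a] cj_fixed_iff[of y a] cj_fixed_iff[of "x \<otimes> y" a]
    by (simp add: cent_def)
qed (auto simp: cent_def)

lemma line_stab_iff:
  assumes "a \<in> noncentral"
  shows "x \<in> line_stab a \<longleftrightarrow> x \<in> carrier G \<and> (cj x a = a \<or> cj x a = inv a)"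
  using conj_commute[OF assms, of x] assms by (auto simp: line_stab_def cj_def)

lemma subgroup_line_stab: "a \<in> noncentral \<Longrightarrow> subgroup (line_stab a) G"
proof (rule subgroupI)
  assume a: "a \<in> noncentral"
  then have aG: "a \<in> carrier G"
    by simp
  show "line_stab a \<noteq> {}"
    using a line_stab_iff[OF a, of \<one>] by auto
  show "inv x \<in> line_stab a" if "x \<in> line_stab a" for x
  proof -
    have x: "x \<in> carrier G" and "cj x a = a \<or> cj x a = inv a"
      using that a by (auto simp: line_stab_iff)
    then have "cj x (cj x a) = a"
      using aG cj_inv by fastforce
    then have "cj (inv x) a = cj x a"
      by (metis aG cj_cj cj_closed cj_one inv_closed l_inv x)
    then show ?thesis
      using x that a by (auto simp: line_stab_iff)
  qed
  show "x \<otimes> y \<in> line_stab a" if "x \<in> line_stab a" "y \<in> line_stab a" for x y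
    using that a aG cj_cj[of x y a, symmetric] by (auto simp: line_stab_iff cj_inv)
qed (auto simp: line_stab_def)

lemma subgroup_center: "subgroup {\<one>, z} G"
proof (rule subgroupI)
  fix x assume "x \<in> {\<one>, z}"
  then show "inv x \<in> {\<one>, z}"
    using z_closed z_square by (auto simp: inv_equality)
qed (use z_closed z_square in auto)

lemma card_center: "card {\<one>, z} = 2"
  using z_neq_one by auto

lemma finite_subgroup: "subgroup H G \<Longrightarrow> finite H"
  using finite_carrier finite_subset subgroup.subset by blast

lemma center_subset_cent: "a \<in> carrier G \<Longrightarrow> {\<one>, z} \<subseteq> cent a"
  using z_closed z_central[of a] by (auto simp: cent_def)

text \<open>The number \<open>k\<close> is the order of the torus modulo the centre; it is at least
  2 because \<open>a\<close> lies in the torus but not in the centre.\<close>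

lemma card_cent:
  assumes "a \<in> noncentral"
  obtains k where "2 \<le> k" "card (cent a) = 2 * k"
proof -
  have ss: "{\<one>, z} \<subset> cent a"
  proof -
    have "{\<one>, z} \<subseteq> cent a" "a \<in> cent a"
      using assms center_subset_cent[of a] by (simp_all add: cent_def)
    then show ?thesis
      using assms by blast
  qed
  have sub: "subgroup (cent a) G"
    using assms subgroup_cent by blast
  have "2 dvd card (cent a)"
    using card_subgroup_dvd[OF subgroup_center sub psubset_imp_subset[OF ss]] unfolding card_center .
  then obtain k where k: "card (cent a) = 2 * k" ..
  moreover have "4 \<le> card (cent a)"
    using double_card_subgroup_le[OF finite_carrier subgroup_center sub ss] unfolding card_center by linarith
  ultimately have "2 \<le> k"
    by linarith
  with k show ?thesis
    using that by blast
qed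

text \<open>An element of \<open>line_stab a\<close> fixes or inverts \<open>a\<close>. If the two
  groups differ, the inverting elements form a single coset of \<open>cent a\<close>.\<close>

lemma card_line_stab:
  assumes a: "a \<in> noncentral"
  shows "card (line_stab a) = card (cent a) \<or> card (line_stab a) = 2 * card (cent a)"
proof (cases "line_stab a = cent a")
  case False
  have aG: "a \<in> carrier G"
    using a by simp
  have CN: "x \<in> cent a \<longleftrightarrow> x \<in> carrier G \<and> cj x a = a" for x
    using aG by (auto simp: cent_def cj_fixed_iff)
  then have sub: "cent a \<subseteq> line_stab a"
    using a by (auto simp: line_stab_iff)
  with False obtain x where "x \<in> line_stab a" "x \<notin> cent a"
    by blast
  then have x: "x \<in> carrier G" "cj x a = inv a" and ne: "inv a \<noteq> a"
    using a CN by (auto simp: line_stab_iff)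
  have "bij_betw (\<lambda>y. x \<otimes> y) (cent a) (line_stab a - cent a)"
  proof (rule bij_betwI[where g = "\<lambda>y. inv x \<otimes> y"])
    show "(\<otimes>) x \<in> cent a \<rightarrow> line_stab a - cent a"
      using x ne aG a by (auto simp: CN line_stab_iff cj_cj[symmetric])
    show "(\<otimes>) (inv x) \<in> line_stab a - cent a \<rightarrow> cent a"
    proof
      fix y assume "y \<in> line_stab a - cent a"
      then have y: "y \<in> carrier G" "cj y a = inv a"
        using a CN by (auto simp: line_stab_iff)
      have "cj (inv x \<otimes> y) a = cj (inv x) (cj y a)"
        using x(1) y(1) aG by (simp only: cj_cj inv_closed)
      also have "\<dots> = cj (inv x) (cj x a)"
        using x y by simp
      also have "\<dots> = a"
        using x(1) aG by simp
      finally show "inv x \<otimes> y \<in> cent a"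
        using x y by (simp add: CN)
    qed
  qed (use x in \<open>auto simp: CN line_stab_def m_assoc[symmetric]\<close>)
  then have "card (line_stab a - cent a) = card (cent a)"
    by (simp add: bij_betw_same_card)
  moreover have "card (line_stab a - cent a) = card (line_stab a) - card (cent a)"
    using sub by (simp add: card_Diff_subset finite_subgroup subgroup_cent aG)
  moreover have "card (cent a) \<le> card (line_stab a)"
    using card_mono[OF finite_subgroup[OF subgroup_line_stab[OF a]] sub] .
  ultimately show ?thesis
    by linarith
qed simp

section \<open>Sizes of the torus classes\<close>

text \<open>Pairs of a group element \<open>x\<close> and a noncentral element \<open>t\<close> of
  the torus of \<open>a\<close> are counted through the map to \<open>cj x t\<close>. Every fibre
  over the class is in bijection with \<open>line_stab a\<close>.\<close>

lemma card_torus_class: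
  assumes a: "a \<in> noncentral"
  shows "card (torus_class a) * card (line_stab a) = order G * (card (cent a) - 2)"
proof -
  have aG: "a \<in> carrier G"
    using a by simp
  define T where "T = cent a - {\<one>, z}"
  have T: "t \<in> T \<longleftrightarrow> t \<in> noncentral \<and> com t a" for t
    by (auto simp: T_def cent_def)
  have finT: "finite T"
    by (rule finite_subset[OF _ finite_carrier]) (auto simp: T_def cent_def)
  define D where "D = carrier G \<times> T"
  have finD: "finite D"
    using finite_carrier finT by (simp add: D_def)
  have fin_class: "finite (torus_class a)"
    by (rule finite_subset[OF _ finite_carrier]) (auto simp: torus_class_def)
  have maps: "cj x t \<in> torus_class a" if "x \<in> carrier G" "t \<in> T" for x t
    using that aG com_cj[of x a t] cj_noncentral[of x t] by (auto simp: torus_class_def T)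
  have fibre: "card {d \<in> D. (\<lambda>(x, t). cj x t) d = e} = card (line_stab a)"
    if e_class: "e \<in> torus_class a" for e
  proof -
    obtain x0 where x0: "x0 \<in> carrier G" "com (cj x0 a) e" and e: "e \<in> noncentral"
      using e_class by (auto simp: torus_class_def)
    define t0 where "t0 = cj (inv x0) e"
    have et0: "e = cj x0 t0"
      using x0 e by (simp add: t0_def cj_cj)
    have t0: "t0 \<in> T"
    proof -
      have "t0 \<in> noncentral"
        unfolding t0_def using x0 e cj_noncentral by blast
      then show ?thesis
        using x0 aG com_cj[of x0 a t0] by (auto simp: T et0)
    qed
    \<comment> \<open>All pairs over \<open>e\<close> arise from \<open>(x0, t0)\<close> by shifting
      a factor \<open>y\<close> between the components, where \<open>y\<close> has to preserve the
      torus of \<open>a\<close>.\<close>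
    have "bij_betw (\<lambda>y. (x0 \<otimes> y, cj (inv y) t0)) (line_stab a) {d \<in> D. (\<lambda>(x, t). cj x t) d = e}"
    proof (rule bij_betwI[where g = "\<lambda>(x, t). inv x0 \<otimes> x"])
      show "(\<lambda>y. (x0 \<otimes> y, cj (inv y) t0)) \<in> line_stab a \<rightarrow> {d \<in> D. (\<lambda>(x, t). cj x t) d = e}"
      proof
        fix y assume y': "y \<in> line_stab a"
        then have y: "y \<in> carrier G" "com (cj y a) a"
          by (auto simp: line_stab_def)
        \<comment> \<open>By commuting transitivity it makes no difference whether preservation of
          the torus is tested on \<open>a\<close> or on \<open>t0\<close>.\<close>
        have "com (cj y a) t0"
          using commute_trans[of "cj y a" a t0] cj_noncentral[of y a] y a t0 by (auto simp: T)
        then have "com (cj (inv y) (cj y a)) (cj (inv y) t0)"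
          using com_cj[of "inv y" "cj y a" t0] y aG t0 by (auto simp: T)
        moreover have "cj (inv y) (cj y a) = a"
          using y aG by (simp only: cj_cj inv_closed l_inv cj_one)
        ultimately have "cj (inv y) t0 \<in> T"
          using cj_noncentral[of "inv y" t0] y t0 by (auto simp: T)
        moreover have "cj (x0 \<otimes> y) (cj (inv y) t0) = e"
          using x0 y t0 by (simp add: cj_cj m_assoc et0 T)
        ultimately show "(x0 \<otimes> y, cj (inv y) t0) \<in> {d \<in> D. (\<lambda>(x, t). cj x t) d = e}"
          using x0 y by (auto simp: D_def)
      qed
      show "(\<lambda>(x, t). inv x0 \<otimes> x) \<in> {d \<in> D. (\<lambda>(x, t). cj x t) d = e} \<rightarrow> line_stab a"
      proof clarify
        fix x t assume "(x, t) \<in> D" and et: "e = cj x t"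
        then have x: "x \<in> carrier G" and t: "t \<in> T"
          by (auto simp: D_def)
        define y where "y = inv x0 \<otimes> x"
        have y: "y \<in> carrier G"
          using x x0 by (simp add: y_def)
        have "cj y t = t0"
          using x x0 t by (simp add: y_def t0_def et cj_cj T)
        then have "com (cj y a) t0"
          using com_cj[of y a t] y aG t by (auto simp: T)
        then have "com (cj y a) a"
          using commute_trans[of "cj y a" t0 a] cj_noncentral[of y a] y a t0 by (auto simp: T)
        then show "inv x0 \<otimes> x \<in> line_stab a"
          using y by (auto simp: line_stab_def y_def)
      qed
      show "(case (x0 \<otimes> y, cj (inv y) t0) of (x, t) \<Rightarrow> inv x0 \<otimes> x) = y" if "y \<in> line_stab a" for y
        using that x0 by (simp add: line_stab_def m_assoc[symmetric])
      show "(x0 \<otimes> (case d of (x, t) \<Rightarrow> inv x0 \<otimes> x), cj (inv (case d of (x, t) \<Rightarrow> inv x0 \<otimes> x)) t0) = d"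
        if "d \<in> {d \<in> D. (\<lambda>(x, t). cj x t) d = e}" for d
      proof -
        obtain x t where d: "d = (x, t)" "x \<in> carrier G" "t \<in> T" "e = cj x t"
          using \<open>d \<in> _\<close> by (auto simp: D_def)
        have tG: "t \<in> carrier G"
          using d by (auto simp: T)
        have "cj (inv (inv x0 \<otimes> x)) t0 = t"
          using d x0 tG by (simp add: t0_def inv_mult_group cj_cj[symmetric])
        then show ?thesis
          using d x0 by (simp add: m_assoc[symmetric])
      qed
    qed
    then show ?thesis
      by (simp add: bij_betw_same_card)
  qed
  have "card D = (\<Sum>e\<in>torus_class a. card {d \<in> D. (\<lambda>(x, t). cj x t) d = e})"
    using sum.group[OF finD fin_class, of "\<lambda>(x, t). cj x t" "\<lambda>_. 1::nat"] maps
    by (auto simp: D_def image_subset_iff)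
  also have "\<dots> = card (torus_class a) * card (line_stab a)"
    using fibre by simp
  finally have "card D = card (torus_class a) * card (line_stab a)" .
  moreover have "card T = card (cent a) - 2"
    unfolding T_def using center_subset_cent[OF aG] card_center by (simp add: card_Diff_subset)
  ultimately show ?thesis
    by (simp add: D_def card_cartesian_product order_def)
qed

text \<open>A common element commutes with a conjugate of \<open>a\<close> and with a conjugate of
  \<open>b\<close>. By transitivity these two commute, and conjugating back places \<open>b\<close>
  in the class of \<open>a\<close>.\<close>

lemma torus_class_disjoint:
  assumes a: "a \<in> noncentral" and b: "b \<in> noncentral" "b \<notin> torus_class a"
  shows "torus_class a \<inter> torus_class b = {}"
proof (rule ccontr)
  assume "torus_class a \<inter> torus_class b \<noteq> {}"
  then obtain c x y where c: "c \<in> noncentral" and x: "x \<in> carrier G" "com (cj x a) c"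
    and y: "y \<in> carrier G" "com (cj y b) c"
    by (auto simp: torus_class_def)
  have "com (cj x a) (cj y b)"
    using commute_trans[of "cj x a" c "cj y b"] cj_noncentral[of x a] cj_noncentral[of y b] x y a b c
    by auto
  then have "com (cj (inv y) (cj x a)) (cj (inv y) (cj y b))"
    using com_cj[of "inv y" "cj x a" "cj y b"] x y a b by auto
  then have "com (cj (inv y \<otimes> x) a) b"
    using x y a b by (simp add: cj_cj)
  then show False
    using x y b by (auto simp: torus_class_def)
qed

text \<open>Conjugation moves \<open>b\<close> into the centralizer of \<open>a\<close>, where sixth
  powers are trivial. The cube therefore squares to 1, and the only such elements are
  central.\<close>

lemma torus_class_cube:
  assumes a: "a \<in> noncentral" and "card (cent a) = 6" and b: "b \<in> torus_class a"
  shows "b [^] (3::nat) \<in> {\<one>, z}"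
proof -
  obtain x where x: "x \<in> carrier G" "com (cj x a) b" and bG: "b \<in> carrier G"
    using b by (auto simp: torus_class_def)
  have aG: "a \<in> carrier G"
    using a by simp
  define t where "t = cj (inv x) b"
  have tG: "t \<in> carrier G"
    using x bG by (simp add: t_def)
  have bt: "b = cj x t"
    using x bG by (simp add: t_def cj_cj)
  have tC: "t \<in> cent a"
    using x com_cj[of x a t] aG tG by (auto simp: cent_def bt)
  interpret C: group "G\<lparr>carrier := cent a\<rparr>"
    by (rule subgroup_imp_group[OF subgroup_cent[OF aG]])
  have "t [^]\<^bsub>G\<lparr>carrier := cent a\<rparr>\<^esub> order (G\<lparr>carrier := cent a\<rparr>) = \<one>\<^bsub>G\<lparr>carrier := cent a\<rparr>\<^esub>"
    using C.pow_order_eq_1[of t] tC by simp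
  then have "t [^] (6::nat) = \<one>"
    using assms(2) by (simp add: order_def nat_pow_consistent[symmetric])
  then have "t [^] (3::nat) \<otimes> t [^] (3::nat) = \<one>"
    using tG by (simp add: nat_pow_mult)
  then have "t [^] (3::nat) \<in> {\<one>, z}"
    using square_eq_one tG by blast
  moreover have "b [^] (3::nat) = cj x (t [^] (3::nat))"
    using x tG by (simp add: bt numeral_3_eq_3 cj_mult)
  ultimately show ?thesis
    using cj_central[OF x(1)] by simp
qed


section \<open>Counting the noncentral elements of an irreducible group\<close>

text \<open>For a subgroup of \<open>SL(2,p)\<close> the second condition says that the group does
  not fix the axis of any of its own noncentral elements.\<close>

definition irreducible_group :: bool where
  "irreducible_group \<longleftrightarrow> noncentral \<noteq> {} \<and> (\<forall>a\<in>noncentral. line_stab a \<noteq> carrier G)"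

text \<open>The cases correspond to index 1 and 2 of the torus in its normalizer. By irreducibility
  the normalizer is a proper subgroup, so it has at most half the order of the group, which bounds
  \<open>k\<close>.\<close>

lemma torus_class_density:
  assumes irr: irreducible_group and a: "a \<in> noncentral"
  obtains k :: nat where "2 \<le> k" "card (cent a) = 2 * k"
    and "real (card (torus_class a)) = real (order G) * (1 - 1 / k) \<and> 4 * real k \<le> real (order G) \<or>
         real (card (torus_class a)) = real (order G) * (1 / 2 - 1 / (2 * real k)) \<and> 8 * real k \<le> real (order G)"
proof -
  obtain k where k: "2 \<le> k" "card (cent a) = 2 * k"
    using card_cent[OF a] .
  have "line_stab a \<subset> carrier G"
    using irr a by (auto simp: irreducible_group_def line_stab_def)
  then have le: "2 * card (line_stab a) \<le> order G"
    using double_card_subgroup_le[OF finite_carrier subgroup_line_stab[OF a] subgroup_self] by (simp add: order_def)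
  have eq: "real (card (torus_class a)) * real (card (line_stab a)) = real (order G) * (2 * real k - 2)"
    using arg_cong[OF card_torus_class[OF a], of real] k by (simp add: of_nat_diff)
  from card_line_stab[OF a] show ?thesis
  proof
    assume n: "card (line_stab a) = card (cent a)"
    then have "real (card (torus_class a)) * (2 * real k) = real (order G) * (2 * real k - 2)"
      using eq k by simp
    then have "real (card (torus_class a)) = real (order G) * (1 - 1 / k)"
      using k(1) by (simp add: field_simps)
    moreover have "4 * real k \<le> real (order G)"
      using le n k by linarith
    ultimately show ?thesis
      using that k by blast
  next
    assume n: "card (line_stab a) = 2 * card (cent a)"
    then have "real (card (torus_class a)) * (4 * real k) = real (order G) * (2 * real k - 2)"
      using eq k by simp
    then have "real (card (torus_class a)) = real (order G) * (1 / 2 - 1 / (2 * real k))"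
      using k(1) by (simp add: field_simps)
    moreover have "8 * real k \<le> real (order G)"
      using le n k by linarith
    ultimately show ?thesis
      using that k by blast
  qed
qed

lemma card_noncentral: "real (card noncentral) = real (order G) - 2"
proof -
  have "card noncentral = order G - 2" and "2 \<le> order G"
    using card_center z_closed finite_carrier card_mono[of "carrier G" "{\<one>, z}"]
    by (simp_all add: card_Diff_subset order_def)
  then show ?thesis
    by (simp add: of_nat_diff)
qed

lemma finite_noncentral: "finite noncentral"
  using finite_carrier by simp

lemma torus_class_subset: "torus_class a \<subseteq> noncentral"
  by (auto simp: torus_class_def)

lemma finite_torus_class: "finite (torus_class a)"
  using finite_noncentral torus_class_subset by (rule finite_subset[rotated])

lemma card_two_classes:
  assumes "a \<in> noncentral" "b \<in> noncentral" "b \<notin> torus_class a"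
  shows "card (torus_class a \<union> torus_class b) = card (torus_class a) + card (torus_class b)"
  using torus_class_disjoint[OF assms] finite_torus_class by (simp add: card_Un_disjoint)

lemma card_three_classes:
  assumes "a \<in> noncentral" "b \<in> noncentral" "b \<notin> torus_class a"
    and "c \<in> noncentral" "c \<notin> torus_class a" "c \<notin> torus_class b"
  shows "card (torus_class a \<union> torus_class b \<union> torus_class c) =
    card (torus_class a) + card (torus_class b) + card (torus_class c)"
proof -
  have "(torus_class a \<union> torus_class b) \<inter> torus_class c = {}"
    using torus_class_disjoint assms by blast
  then show ?thesis
    using card_two_classes[OF assms(1-3)] finite_torus_class by (simp add: card_Un_disjoint)
qed

lemma card_four_classes:
  assumes "a \<in> noncentral" "b \<in> noncentral" "b \<notin> torus_class a"
    and "c \<in> noncentral" "c \<notin> torus_class a" "c \<notin> torus_class b"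
    and "d \<in> noncentral" "d \<notin> torus_class a" "d \<notin> torus_class b" "d \<notin> torus_class c"
  shows "card (torus_class a) + card (torus_class b) + card (torus_class c) + card (torus_class d)
    \<le> card noncentral"
proof -
  have "(torus_class a \<union> torus_class b \<union> torus_class c) \<inter> torus_class d = {}"
    using torus_class_disjoint assms by blast
  then have "card (torus_class a \<union> torus_class b \<union> torus_class c \<union> torus_class d) =
      card (torus_class a) + card (torus_class b) + card (torus_class c) + card (torus_class d)"
    using card_three_classes[OF assms(1-6)] finite_torus_class by (simp add: card_Un_disjoint)
  moreover have "torus_class a \<union> torus_class b \<union> torus_class c \<union> torus_class d \<subseteq> noncentral"
    using torus_class_subset by blast
  ultimately show ?thesis
    using card_mono[OF finite_noncentral] by metis
qed

text \<open>In an irreducible group this singles out the self-normalizing tori: their classes have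
  density \<open>1 - 1 / k\<close>, at least 1/2, and all other classes have density below
  1/2.\<close>

definition large_class :: "'a \<Rightarrow> bool" where
  "large_class a \<longleftrightarrow> real (order G) \<le> 2 * real (card (torus_class a))"

text \<open>A large class covers at least half of the group and any other class at least a quarter.
  As only \<open>order G - 2\<close> elements are noncentral, there is exactly one further class,
  and it is not large. Counting the two classes gives the equation of
  \<open>unit_fraction_sum_two\<close>.\<close>

lemma irreducible_order_of_large:
  assumes irr: irreducible_group and a: "a \<in> noncentral" and large: "large_class a"
  shows "order G = 24" and "card (cent a) = 6" and "card (torus_class a) = 16"
proof -
  define g where "g = real (order G)"
  have "g > 0"
    using finite_carrier order_gt_0_iff_finite by (simp add: g_def)
  obtain k where k: "2 \<le> k" "card (cent a) = 2 * k"
    and dens: "real (card (torus_class a)) = g * (1 - 1 / k) \<and> 4 * real k \<le> g \<or>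
         real (card (torus_class a)) = g * (1 / 2 - 1 / (2 * real k)) \<and> 8 * real k \<le> g"
    using torus_class_density[OF irr a] unfolding g_def by metis
  have "g * (1 / 2 - 1 / (2 * real k)) < g * (1 / 2)"
    using \<open>g > 0\<close> k(1) by (intro mult_strict_left_mono) auto
  then have ea: "real (card (torus_class a)) = g * (1 - 1 / k)" and kg: "4 * real k \<le> g"
    using dens large by (auto simp: large_class_def g_def)
  have "torus_class a \<noteq> noncentral"
  proof
    assume "torus_class a = noncentral"
    then have "g * (1 - 1 / k) = g - 2"
      using ea card_noncentral by (simp add: g_def)
    \<comment> \<open>The centralizer of \<open>a\<close> would have the order of the whole
      group.\<close>
    then have "g = 2 * real k"
      using k(1) by (simp add: field_simps)
    with kg k(1) show False
      by linarith
  qed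
  then obtain b where b: "b \<in> noncentral" "b \<notin> torus_class a"
    using torus_class_subset by blast
  obtain l where l: "2 \<le> l" "card (cent b) = 2 * l"
    and densb: "real (card (torus_class b)) = g * (1 - 1 / l) \<and> 4 * real l \<le> g \<or>
         real (card (torus_class b)) = g * (1 / 2 - 1 / (2 * real l)) \<and> 8 * real l \<le> g"
    using torus_class_density[OF irr b(1)] unfolding g_def by metis
  have half: "g * (1 / 2) \<le> g * (1 - 1 / j)" if "2 \<le> j" for j :: nat
    using \<open>g > 0\<close> that by (intro mult_left_mono) (auto simp: field_simps)
  have quarter: "g * (1 / 4) \<le> g * (1 / 2 - 1 / (2 * real j))" if "2 \<le> j" for j :: nat
    using \<open>g > 0\<close> that by (intro mult_left_mono) (auto simp: field_simps)
  have le_ab: "real (card (torus_class a)) + real (card (torus_class b)) \<le> g - 2"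
    using card_two_classes[OF a b] card_noncentral
      card_mono[OF finite_noncentral, of "torus_class a \<union> torus_class b"] torus_class_subset
    by (metis Un_least g_def of_nat_add of_nat_mono)
  then have eb: "real (card (torus_class b)) = g * (1 / 2 - 1 / (2 * real l))" and lg: "8 * real l \<le> g"
    using densb ea half[OF k(1)] half[OF l(1)] \<open>g > 0\<close> by auto
  have all: "torus_class a \<union> torus_class b = noncentral"
  proof (rule ccontr)
    assume "torus_class a \<union> torus_class b \<noteq> noncentral"
    then obtain c where c: "c \<in> noncentral" "c \<notin> torus_class a" "c \<notin> torus_class b"
      using torus_class_subset by blast
    obtain m :: nat where m: "2 \<le> m"
      and densc: "real (card (torus_class c)) = g * (1 - 1 / m) \<or>
         real (card (torus_class c)) = g * (1 / 2 - 1 / (2 * real m))"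
      using torus_class_density[OF irr c(1)] unfolding g_def by metis
    have "card (torus_class a) + card (torus_class b) + card (torus_class c) \<le> card noncentral"
      using card_three_classes[OF a b c] card_mono[OF finite_noncentral] torus_class_subset
      by (metis Un_least)
    then have "real (card (torus_class a)) + real (card (torus_class b)) + real (card (torus_class c)) \<le> g - 2"
      using card_noncentral unfolding g_def by linarith
    with ea eb densc half[OF k(1)] half[OF m] quarter[OF l(1)] quarter[OF m] \<open>g > 0\<close> show False
      by auto
  qed
  have "real (card (torus_class a)) + real (card (torus_class b)) = g - 2"
    using card_two_classes[OF a b] card_noncentral by (simp add: all g_def)
  then have "g * (1 - 1 / k) + g * (1 / 2 - 1 / (2 * real l)) = g - 2"
    by (simp only: ea eb)
  then have "1 / k + 1 / (2 * real l) = 1 / 2 + 2 / g"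
    using \<open>g > 0\<close> k(1) l(1) by (simp add: field_simps)
  then have "k = 3" "g = 24"
    using unit_fraction_sum_two[OF k(1) l(1) lg] by auto
  then show "order G = 24" "card (cent a) = 6" "card (torus_class a) = 16"
    using k ea by (auto simp: g_def)
qed

text \<open>Every class now has density at least 1/4 and below 1/2. One class is too small, two
  would leave at least eight elements uncovered instead of the two central ones, and four would
  cover too much. Three classes give the equation of \<open>unit_fraction_sum\<close>, where order
  24 means that two of the centralizers have order 6.\<close>

lemma irreducible_order_of_small:
  assumes irr: irreducible_group and small: "\<And>a. a \<in> noncentral \<Longrightarrow> \<not> large_class a"
  shows "order G \<in> {24, 48, 120}"
    and "order G = 24 \<Longrightarrow> \<exists>a\<in>noncentral. \<exists>b\<in>noncentral. b \<notin> torus_class a \<and>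
      card (cent a) = 6 \<and> card (cent b) = 6 \<and> card (torus_class a) = 8 \<and> card (torus_class b) = 8"
proof -
  define g where "g = real (order G)"
  have "g > 0"
    using finite_carrier order_gt_0_iff_finite by (simp add: g_def)
  have half: "g * (1 / 2) \<le> g * (1 - 1 / j)" if "2 \<le> j" for j :: nat
    using \<open>g > 0\<close> that by (intro mult_left_mono) (auto simp: field_simps)
  have quarter: "g * (1 / 4) \<le> g * (1 / 2 - 1 / (2 * real j))" if "2 \<le> j" for j :: nat
    using \<open>g > 0\<close> that by (intro mult_left_mono) (auto simp: field_simps)
  have dens: "\<exists>k::nat. 2 \<le> k \<and> card (cent a) = 2 * k \<and> 8 * real k \<le> g \<and>
      real (card (torus_class a)) = g * (1 / 2 - 1 / (2 * real k))" if a: "a \<in> noncentral" for a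
  proof -
    obtain k where k: "2 \<le> k" "card (cent a) = 2 * k"
      and dens: "real (card (torus_class a)) = g * (1 - 1 / k) \<and> 4 * real k \<le> g \<or>
           real (card (torus_class a)) = g * (1 / 2 - 1 / (2 * real k)) \<and> 8 * real k \<le> g"
      using torus_class_density[OF irr a] unfolding g_def by metis
    have "real (card (torus_class a)) \<noteq> g * (1 - 1 / k)"
      using small[OF a] half[OF k(1)] unfolding large_class_def g_def by linarith
    with dens k show ?thesis
      by (intro exI[of _ k]) simp
  qed
  obtain a where a: "a \<in> noncentral"
    using irr by (auto simp: irreducible_group_def)
  obtain k where k: "2 \<le> k" "card (cent a) = 2 * k" "8 * real k \<le> g"
      "real (card (torus_class a)) = g * (1 / 2 - 1 / (2 * real k))"
    using dens[OF a] by blast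
  have "torus_class a \<noteq> noncentral"
  proof
    assume "torus_class a = noncentral"
    then have "real (card (torus_class a)) = g - 2"
      using card_noncentral by (simp add: g_def)
    moreover have "\<not> g \<le> 2 * real (card (torus_class a))"
      using small[OF a] by (simp add: large_class_def g_def)
    ultimately show False
      using k by linarith
  qed
  then obtain b where b: "b \<in> noncentral" "b \<notin> torus_class a"
    using torus_class_subset by blast
  obtain l where l: "2 \<le> l" "card (cent b) = 2 * l" "8 * real l \<le> g"
      "real (card (torus_class b)) = g * (1 / 2 - 1 / (2 * real l))"
    using dens[OF b(1)] by blast
  have "torus_class a \<union> torus_class b \<noteq> noncentral"
  proof
    assume all: "torus_class a \<union> torus_class b = noncentral"
    have "real (card (torus_class a)) + real (card (torus_class b)) = g - 2"
      using card_two_classes[OF a b] card_noncentral by (simp add: all g_def)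
    then have "g * (1 / (2 * real k)) + g * (1 / (2 * real l)) = 2"
      using k l by (simp add: algebra_simps)
    moreover have "g * (1 / (2 * real k)) \<ge> 4" "g * (1 / (2 * real l)) \<ge> 4"
      using k l by (simp_all add: field_simps)
    ultimately show False
      by linarith
  qed
  then obtain c where c: "c \<in> noncentral" "c \<notin> torus_class a" "c \<notin> torus_class b"
    using torus_class_subset by blast
  obtain m where m: "2 \<le> m" "card (cent c) = 2 * m" "8 * real m \<le> g"
      "real (card (torus_class c)) = g * (1 / 2 - 1 / (2 * real m))"
    using dens[OF c(1)] by blast
  have all: "torus_class a \<union> torus_class b \<union> torus_class c = noncentral"
  proof (rule ccontr)
    assume "torus_class a \<union> torus_class b \<union> torus_class c \<noteq> noncentral"
    then obtain d where d: "d \<in> noncentral" "d \<notin> torus_class a" "d \<notin> torus_class b" "d \<notin> torus_class c"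
      using torus_class_subset by blast
    obtain n where n: "2 \<le> n" "real (card (torus_class d)) = g * (1 / 2 - 1 / (2 * real n))"
      using dens[OF d(1)] by blast
    have "real (card (torus_class a)) + real (card (torus_class b)) + real (card (torus_class c)) +
        real (card (torus_class d)) \<le> g - 2"
      using card_four_classes[OF a b c d] card_noncentral unfolding g_def by linarith
    then show False
      using k l m n quarter[OF k(1)] quarter[OF l(1)] quarter[OF m(1)] quarter[OF n(1)] by linarith
  qed
  have "real (card (torus_class a)) + real (card (torus_class b)) + real (card (torus_class c)) = g - 2"
    using card_three_classes[OF a b c] card_noncentral by (simp add: all g_def)
  then have "g * (1 / 2 - 1 / (2 * real k)) + g * (1 / 2 - 1 / (2 * real l)) + g * (1 / 2 - 1 / (2 * real m)) = g - 2"
    using k l m by simp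
  then have sum: "1 / k + 1 / l + 1 / m = 1 + 4 / g"
    using \<open>g > 0\<close> k(1) l(1) m(1) by (simp add: field_simps)
  note * = unit_fraction_sum[OF k(1) l(1) m(1) k(3) l(3) m(3) sum]
  from *(1) show "order G \<in> {24, 48, 120}"
    by (auto simp: g_def)
  assume "order G = 24"
  then have g: "g = 24"
    by (simp add: g_def)
  from *(2)[OF g] show "\<exists>a\<in>noncentral. \<exists>b\<in>noncentral. b \<notin> torus_class a \<and>
      card (cent a) = 6 \<and> card (cent b) = 6 \<and> card (torus_class a) = 8 \<and> card (torus_class b) = 8"
  proof (elim disjE conjE)
    assume "k = 3" "l = 3" then show ?thesis
      using k l g a b by (intro bexI[of _ a] bexI[of _ b]) auto
  next
    assume "k = 3" "m = 3" then show ?thesis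
      using k m g a c by (intro bexI[of _ a] bexI[of _ c]) auto
  next
    assume "l = 3" "m = 3" then show ?thesis
      using l m g b c by (intro bexI[of _ b] bexI[of _ c]) auto
  qed
qed

text \<open>These are the orders of the binary tetrahedral, octahedral and icosahedral
  groups.\<close>

theorem irreducible_order:
  assumes irreducible_group
  shows "order G \<in> {24, 48, 120}"
proof (cases "\<exists>a\<in>noncentral. large_class a")
  case True
  then show ?thesis
    using irreducible_order_of_large(1)[OF assms] by auto
next
  case False
  then show ?thesis
    using irreducible_order_of_small(1)[OF assms] by simp
qed

section \<open>Irreducible groups of order 24\<close>

text \<open>Modulo the centre these are the eight elements of order 3 in the alternating group of
  degree 4. The count supplies them as one large class of 16 elements or as two classes of
  8.\<close>

lemma elements_of_order_3_mod_center:
  assumes irr: irreducible_group and "order G = 24"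
  shows "\<exists>X \<subseteq> noncentral. card X = 16 \<and> (\<forall>x\<in>X. x [^] (3::nat) \<in> {\<one>, z})"
proof (cases "\<exists>a\<in>noncentral. large_class a")
  case True
  then obtain a where a: "a \<in> noncentral" "large_class a"
    by blast
  then have "card (cent a) = 6" "card (torus_class a) = 16"
    using irreducible_order_of_large[OF irr a] by auto
  then show ?thesis
    using torus_class_cube[OF a(1)] by (intro exI[of _ "torus_class a"] conjI ballI torus_class_subset)
next
  case False
  then obtain a b where a: "a \<in> noncentral" and b: "b \<in> noncentral" "b \<notin> torus_class a"
    and *: "card (cent a) = 6" "card (cent b) = 6" "card (torus_class a) = 8" "card (torus_class b) = 8"
    using irreducible_order_of_small(2)[OF irr] assms(2) by blast
  show ?thesis
  proof (intro exI[of _ "torus_class a \<union> torus_class b"] conjI ballI)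
    show "torus_class a \<union> torus_class b \<subseteq> noncentral"
      using torus_class_subset by blast
    show "card (torus_class a \<union> torus_class b) = 16"
      using card_two_classes[OF a b] * by simp
    show "x [^] (3::nat) \<in> {\<one>, z}" if "x \<in> torus_class a \<union> torus_class b" for x
      using that torus_class_cube[OF a *(1), of x] torus_class_cube[OF b(1) *(2), of x] by (elim UnE)
  qed
qed

lemma index_2_square_mem:
  assumes P: "subgroup P G" and "2 * card P = order G" and x: "x \<in> carrier G"
  shows "x \<otimes> x \<in> P"
proof (cases "x \<in> P")
  case False
  interpret P: subgroup P G by fact
  have sub: "P \<union> (\<lambda>y. x \<otimes> y) ` P \<subseteq> carrier G"
    using P.subset x by auto
  have disj: "P \<inter> (\<lambda>y. x \<otimes> y) ` P = {}"
  proof (rule ccontr)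
    assume "P \<inter> (\<lambda>y. x \<otimes> y) ` P \<noteq> {}"
    then obtain y where y: "y \<in> P" "x \<otimes> y \<in> P"
      by blast
    then have "(x \<otimes> y) \<otimes> inv y \<in> P"
      by blast
    then show False
      using False x y P.mem_carrier by (simp add: m_assoc)
  qed
  have "inj_on (\<lambda>y. x \<otimes> y) P"
    using x P.mem_carrier by (auto simp: inj_on_def)
  then have "card (P \<union> (\<lambda>y. x \<otimes> y) ` P) = card (carrier G)"
    using disj assms(2) finite_subgroup[OF P] by (simp add: card_Un_disjoint card_image order_def)
  then have all: "P \<union> (\<lambda>y. x \<otimes> y) ` P = carrier G"
    using sub finite_carrier card_subset_eq by blast
  show ?thesis
  proof (rule ccontr)
    assume "x \<otimes> x \<notin> P"
    then obtain y where "y \<in> P" "x \<otimes> x = x \<otimes> y"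
      using all x by blast
    then show False
      using False x P.mem_carrier by simp
  qed
qed (use subgroup.m_closed[OF P] in blast)

text \<open>Modulo the centre a group of order 24 satisfying the hypotheses is the alternating group of
  degree 4, in which two incomparable subgroups meet trivially.\<close>

lemma comparable_subgroups_order_24:
  assumes irr: irreducible_group and "order G = 24"
    and P: "subgroup P G" and Q: "subgroup Q G" and z: "z \<in> P" "z \<in> Q"
    and a: "a \<in> P" "a \<in> Q" "a \<in> noncentral"
  shows "P \<subseteq> Q \<or> Q \<subseteq> P"
proof (rule ccontr)
  assume incomp: "\<not> (P \<subseteq> Q \<or> Q \<subseteq> P)"
  obtain X where X: "X \<subseteq> noncentral" "card X = 16" "\<And>x. x \<in> X \<Longrightarrow> x [^] (3::nat) \<in> {\<one>, z}"
    using elements_of_order_3_mod_center[OF irr assms(2)] by blast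
  have card_compl: "card (carrier G - X) = 8"
    using X assms(2) finite_carrier by (subst card_Diff_subset) (auto simp: order_def finite_subset)
  \<comment> \<open>Each of two incomparable subgroups is shown to be this same set, which is
    absurd.\<close>
  have "S = carrier G - X" if S: "subgroup S G" "z \<in> S" "a \<in> S" and T: "subgroup T G" "z \<in> T" "a \<in> T"
    "\<not> S \<subseteq> T" "\<not> T \<subseteq> S" for S T
  proof -
    interpret S: subgroup S G by fact
    have ST: "subgroup (S \<inter> T) G"
      using S T subgroups_Inter_pair by blast
    \<comment> \<open>Orders at least double along the strict chain from the centre through
      \<open>S \<inter> T\<close> and \<open>S\<close> to the group, so \<open>S\<close> has order
      between 8 and 12.\<close>
    have "{\<one>, z} \<subset> S \<inter> T"
      using S T a(3) by (auto simp: subgroup.one_closed)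
    then have "4 \<le> card (S \<inter> T)"
      using double_card_subgroup_le[OF finite_carrier subgroup_center ST] card_center by simp
    moreover have "2 * card (S \<inter> T) \<le> card S"
      using double_card_subgroup_le[OF finite_carrier ST S(1)] T(4) by blast
    ultimately have ge: "8 \<le> card S"
      by linarith
    have "S \<subset> carrier G"
      using T subgroup.subset S(1) by blast
    then have le: "card S \<le> 12"
      using double_card_subgroup_le[OF finite_carrier S(1) subgroup_self] assms(2) by (simp add: order_def)
    have "card S dvd 24"
      using card_subgroup_dvd[OF S(1) subgroup_self] assms(2) S.subset by (simp add: order_def)
    then obtain q where q: "24 = card S * q"
      by blast
    have "q \<le> 3"
    proof (rule ccontr)
      assume "\<not> q \<le> 3"
      then have "8 * 4 \<le> card S * q"
        using ge by (intro mult_le_mono) auto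
      with q show False
        by simp
    qed
    moreover have "2 \<le> q"
    proof (rule ccontr)
      assume "\<not> 2 \<le> q"
      then have "card S * q \<le> 12 * 1"
        using le by (intro mult_le_mono) auto
      with q show False
        by simp
    qed
    ultimately have "q = 2 \<or> q = 3"
      by linarith
    then have "card S = 12 \<or> card S = 8"
      using q by auto
    then show ?thesis
    proof
      assume "card S = 12"
      \<comment> \<open>A subgroup of index 2 contains all squares. It also contains the cubes of
        elements of \<open>X\<close>, which are central, hence all 16 elements of \<open>X\<close>,
        too many for order 12.\<close>
      then have sq: "x \<otimes> x \<in> S" if "x \<in> carrier G" for x
        using index_2_square_mem[OF S(1) _ that] assms(2) by simp
      have "X \<subseteq> S"
      proof
        fix x assume x: "x \<in> X"
        then have xG: "x \<in> carrier G"
          using X(1) by blast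
        have "x [^] (3::nat) \<in> S"
          using X(3)[OF x] S(2) by auto
        then have "inv (x \<otimes> x) \<otimes> x [^] (3::nat) \<in> S"
          using sq[OF xG] by blast
        moreover have "inv (x \<otimes> x) \<otimes> x [^] (3::nat) = x"
          using xG by (simp add: numeral_3_eq_3 inv_solve_left' m_assoc)
        ultimately show "x \<in> S"
          by simp
      qed
      then have "16 \<le> card S"
        using X(2) card_mono finite_subgroup[OF S(1)] by metis
      with \<open>card S = 12\<close> show ?thesis
        by simp
    next
      assume 8: "card S = 8"
      \<comment> \<open>An element of both would have trivial eighth and sixth powers, hence trivial
        square, and would be central.\<close>
      have "S \<inter> X = {}"
      proof (rule ccontr)
        assume "S \<inter> X \<noteq> {}"
        then obtain x where x: "x \<in> S" "x \<in> X"
          by blast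
        then have xG: "x \<in> carrier G"
          using X(1) by blast
        interpret SG: group "G\<lparr>carrier := S\<rparr>"
          by (rule subgroup_imp_group[OF S(1)])
        have "x [^]\<^bsub>G\<lparr>carrier := S\<rparr>\<^esub> order (G\<lparr>carrier := S\<rparr>) = \<one>\<^bsub>G\<lparr>carrier := S\<rparr>\<^esub>"
          using SG.pow_order_eq_1[of x] x by simp
        then have x8: "x [^] (8::nat) = \<one>"
          using 8 by (simp add: order_def nat_pow_consistent[symmetric])
        have "x [^] (3::nat) \<otimes> x [^] (3::nat) = \<one>"
          using X(3)[OF x(2)] z_square by auto
        then have x6: "x [^] (6::nat) = \<one>"
          using xG by (simp add: nat_pow_mult)
        have "x [^] (8::nat) = x [^] (6::nat) \<otimes> (x \<otimes> x)"
          using xG nat_pow_mult[of x 6 2] by (simp add: numeral_2_eq_2)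
        then have "x \<otimes> x = \<one>"
          using x6 x8 xG by simp
        then show False
          using square_eq_one[OF xG] X(1) x by blast
      qed
      then have "S \<subseteq> carrier G - X"
        using S.subset by blast
      then show ?thesis
        using card_subset_eq[of "carrier G - X" S] card_compl 8 finite_carrier by simp
    qed
  qed
  from this[of P Q] this[of Q P] show False
    using P Q z a incomp by blast
qed

end

section \<open>Lines in the space of trace-free matrices\<close>

definition mk :: "'a \<Rightarrow> 'a \<Rightarrow> 'a \<Rightarrow> 'a \<Rightarrow> 'a::zero ^ 2 ^ 2" where
  "mk a b c d = vector [vector [a, b], vector [c, d]]"

lemma mk_nth [simp]:
  "mk a b c d $ 1 $ 1 = a" "mk a b c d $ 1 $ 2 = b"
  "mk a b c d $ 2 $ 1 = c" "mk a b c d $ 2 $ 2 = d"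
  by (simp_all add: mk_def)

lemma mk_eta: "A = mk (A $ 1 $ 1) (A $ 1 $ 2) (A $ 2 $ 1) (A $ 2 $ 2)"
  by (simp add: vec_eq_iff forall_2)

lemma mk_exhaust: obtains a b c d where "A = mk a b c d"
  using mk_eta by blast

lemma mk_eq_iff [simp]: "mk a b c d = mk a' b' c' d' \<longleftrightarrow> a = a' \<and> b = b' \<and> c = c' \<and> d = d'"
  by (metis mk_nth)

lemma mk_mult [simp]:
  fixes a :: "'a::field"
  shows "mk a b c d ** mk a' b' c' d' =
    mk (a * a' + b * c') (a * b' + b * d') (c * a' + d * c') (c * b' + d * d')"
  by (simp add: vec_eq_iff forall_2 matrix_matrix_mult_def sum_2)

lemma mat_1_mk: "mat 1 = (mk 1 0 0 1 :: 'a::field ^ 2 ^ 2)"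
  by (simp add: vec_eq_iff forall_2 mat_def)

lemma minus_mk [simp]: "- mk a b c d = (mk (-a) (-b) (-c) (-d) :: 'a::field ^ 2 ^ 2)"
  by (simp add: vec_eq_iff forall_2)

lemma det_mk [simp]: "det (mk a b c d :: 'a::field ^ 2 ^ 2) = a * d - b * c"
  by (simp add: det_2)

text \<open>The adjugate is the inverse when the determinant is 1; being polynomial in the entries,
  it allows conjugation to be computed without division.\<close>

definition adj :: "'a::field ^ 2 ^ 2 \<Rightarrow> 'a ^ 2 ^ 2" where
  "adj A = mk (A $ 2 $ 2) (- A $ 1 $ 2) (- A $ 2 $ 1) (A $ 1 $ 1)"

lemma adj_mk [simp]: "adj (mk a b c d) = mk d (-b) (-c) a"
  by (simp add: adj_def)

definition tr :: "'a::field ^ 2 ^ 2 \<Rightarrow> 'a" where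
  "tr A = A $ 1 $ 1 + A $ 2 $ 2"

lemma tr_mk [simp]: "tr (mk a b c d) = a + d"
  by (simp add: tr_def)

definition scalar :: "'a::field ^ 2 ^ 2 \<Rightarrow> bool" where
  "scalar A \<longleftrightarrow> A $ 1 $ 2 = 0 \<and> A $ 2 $ 1 = 0 \<and> A $ 1 $ 1 = A $ 2 $ 2"

lemma scalar_mk [simp]: "scalar (mk a b c d) \<longleftrightarrow> b = 0 \<and> c = 0 \<and> a = d"
  by (simp add: scalar_def)

abbreviation commutes :: "'a::field ^ 2 ^ 2 \<Rightarrow> 'a ^ 2 ^ 2 \<Rightarrow> bool" where
  "commutes A B \<equiv> A ** B = B ** A"

text \<open>The equations are the vanishing of the two-by-two minors of \<open>(a - d, b, c)\<close>
  and \<open>(a' - d', b', c')\<close>, which describe the trace-free parts.\<close>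

lemma commutes_mk:
  fixes a :: "'a::field"
  shows "commutes (mk a b c d) (mk a' b' c' d') \<longleftrightarrow>
    b * c' = b' * c \<and> (a - d) * b' = (a' - d') * b \<and> (a - d) * c' = (a' - d') * c"
  by (simp add: algebra_simps) (auto simp: algebra_simps)

lemma adj_mult: "det A = 1 \<Longrightarrow> adj A ** A = mat 1" "det A = 1 \<Longrightarrow> A ** adj A = mat 1"
  by (cases A rule: mk_exhaust; simp add: mat_1_mk algebra_simps)+

lemma det_adj [simp]: "det (adj A) = det A"
  by (cases A rule: mk_exhaust) (simp add: algebra_simps)

lemma adj_adj [simp]: "adj (adj A) = A"
  by (cases A rule: mk_exhaust) simp

lemma adj_prod: "adj (A ** B) = adj B ** adj A"
  by (cases A rule: mk_exhaust; cases B rule: mk_exhaust) (simp add: algebra_simps)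

text \<open>Two non-scalar matrices commute iff their trace-free parts are proportional, so a non-scalar
  matrix, up to the relation of commuting, stands for a line in the space of trace-free matrices.\<close>

lemma proportional_of_commutes:
  assumes "commutes X Y" "\<not> scalar X"
  obtains r where "Y $ 1 $ 2 = r * X $ 1 $ 2" "Y $ 2 $ 1 = r * X $ 2 $ 1"
    "Y $ 1 $ 1 - Y $ 2 $ 2 = r * (X $ 1 $ 1 - X $ 2 $ 2)"
proof -
  obtain a b c d where X: "X = mk a b c d" by (rule mk_exhaust)
  obtain a' b' c' d' where Y: "Y = mk a' b' c' d'" by (rule mk_exhaust)
  have *: "b * c' = b' * c" "(a - d) * b' = (a' - d') * b" "(a - d) * c' = (a' - d') * c"
    using assms(1) by (simp_all only: X Y commutes_mk)
  from assms(2) consider "b \<noteq> 0" | "c \<noteq> 0" | "a - d \<noteq> 0"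
    by (auto simp: X)
  then show ?thesis
  proof cases
    case 1
    then show ?thesis
      using * by (intro that[of "b' / b"]) (simp_all add: X Y field_simps)
  next
    case 2
    then show ?thesis
      using * by (intro that[of "c' / c"]) (simp_all add: X Y field_simps)
  next
    case 3
    then show ?thesis
      using * by (intro that[of "(a' - d') / (a - d)"]) (simp_all add: X Y field_simps)
  qed
qed

text \<open>The trace-free parts of \<open>X\<close> and \<open>Z\<close> are both multiples of that
  of \<open>Y\<close>.\<close>

lemma commutes_trans:
  assumes "commutes X Y" "commutes Y Z" "\<not> scalar Y"
  shows "commutes X Z"
proof -
  obtain r where r: "X $ 1 $ 2 = r * Y $ 1 $ 2" "X $ 2 $ 1 = r * Y $ 2 $ 1"
    "X $ 1 $ 1 - X $ 2 $ 2 = r * (Y $ 1 $ 1 - Y $ 2 $ 2)"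
    using proportional_of_commutes[of Y X] assms by metis
  obtain s where s: "Z $ 1 $ 2 = s * Y $ 1 $ 2" "Z $ 2 $ 1 = s * Y $ 2 $ 1"
    "Z $ 1 $ 1 - Z $ 2 $ 2 = s * (Y $ 1 $ 1 - Y $ 2 $ 2)"
    using proportional_of_commutes[of Y Z] assms by metis
  show ?thesis
    using r s by (subst (1 2) mk_eta[of X], subst (1 2) mk_eta[of Z]) (simp only: commutes_mk mult_ac)
qed

section \<open>Conjugation, fixed lines and the trace form\<close>

definition conj_by :: "'a::field ^ 2 ^ 2 \<Rightarrow> 'a ^ 2 ^ 2 \<Rightarrow> 'a ^ 2 ^ 2" where
  "conj_by h X = h ** X ** adj h"

text \<open>For \<open>det h = 1\<close> and non-scalar \<open>X\<close> this says that
  \<open>h\<close> maps the line of \<open>X\<close> to itself. Phrased by commuting, it applies to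
  representatives of any trace.\<close>

definition fixes_line :: "'a::field ^ 2 ^ 2 \<Rightarrow> 'a ^ 2 ^ 2 \<Rightarrow> bool" where
  "fixes_line h X \<longleftrightarrow> commutes (conj_by h X) X"

text \<open>Twice the trace form of the trace-free parts.\<close>

definition form :: "'a::field ^ 2 ^ 2 \<Rightarrow> 'a ^ 2 ^ 2 \<Rightarrow> 'a" where
  "form X Y = 2 * tr (X ** Y) - tr X * tr Y"

lemma form_mk: "form (mk a b c d) (mk a' b' c' d') =
    (a - d) * (a' - d') + 2 * (b * c') + 2 * (c * b')"
  by (simp add: form_def algebra_simps)

lemma conj_mk: "conj_by (mk p q r s) (mk a b c d) =
    mk ((p * a + q * c) * s - (p * b + q * d) * r) ((p * b + q * d) * p - (p * a + q * c) * q)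
       ((r * a + s * c) * s - (r * b + s * d) * r) ((r * b + s * d) * p - (r * a + s * c) * q)"
  by (simp add: conj_by_def algebra_simps)

lemma conj_conj: "conj_by g (conj_by h X) = conj_by (g ** h) X"
  by (simp add: conj_by_def adj_prod matrix_mul_assoc)

lemma conj_one [simp]: "conj_by (mat 1) X = X"
  by (cases X rule: mk_exhaust) (simp add: mat_1_mk conj_mk)

lemma conj_adj_cancel [simp]:
  assumes "det h = 1"
  shows "conj_by (adj h) (conj_by h X) = X" "conj_by h (conj_by (adj h) X) = X"
  using assms by (simp_all add: conj_conj adj_mult)

lemma conj_mult:
  assumes "det h = 1"
  shows "conj_by h (X ** Y) = conj_by h X ** conj_by h Y"
proof -
  have "conj_by h X ** conj_by h Y = h ** X ** (adj h ** h) ** Y ** adj h"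
    by (simp add: conj_by_def matrix_mul_assoc)
  then show ?thesis
    using assms by (simp add: adj_mult conj_by_def matrix_mul_assoc)
qed

lemma commutes_conj:
  assumes "det h = 1"
  shows "commutes (conj_by h X) (conj_by h Y) \<longleftrightarrow> commutes X Y"
  using assms by (metis conj_adj_cancel(1) conj_mult)

lemma commutes_scalar: "scalar X \<Longrightarrow> commutes X Y"
  by (cases X rule: mk_exhaust; cases Y rule: mk_exhaust) (simp add: mult.commute)

lemma scalar_conj:
  assumes "det h = 1"
  shows "scalar (conj_by h X) \<longleftrightarrow> scalar X"
proof -
  have "scalar (conj_by h X)" if "scalar X" "det h = 1" for h X :: "'a ^ 2 ^ 2"
  proof -
    have "conj_by h X = X ** (h ** adj h)"
      using commutes_scalar[OF that(1), of h] by (simp add: conj_by_def matrix_mul_assoc)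
    then show ?thesis
      using that by (simp add: adj_mult)
  qed
  then show ?thesis
    using assms by (metis conj_adj_cancel(1) det_adj)
qed

lemma tr_conj:
  assumes "det h = 1"
  shows "tr (conj_by h X) = tr X"
proof -
  obtain p q r s where h: "h = mk p q r s" by (rule mk_exhaust)
  obtain a b c d where X: "X = mk a b c d" by (rule mk_exhaust)
  have "tr (conj_by h X) = (p * s - q * r) * tr X"
    unfolding h X conj_mk tr_mk by (simp add: algebra_simps)
  then show ?thesis
    using assms by (simp add: h)
qed

lemma conj_fixed_iff:
  assumes "det h = 1"
  shows "conj_by h X = X \<longleftrightarrow> commutes h X"
proof -
  have "conj_by h X ** h = h ** X"
    using assms by (simp add: conj_by_def matrix_mul_assoc[symmetric] adj_mult)
  moreover have "(X ** h) ** adj h = X" "(h ** X) ** adj h = conj_by h X"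
    using assms by (simp_all add: conj_by_def matrix_mul_assoc[symmetric] adj_mult)
  ultimately show ?thesis
    by metis
qed

lemma form_conj:
  assumes "det h = 1"
  shows "form (conj_by h X) (conj_by h Y) = form X Y"
  using assms by (simp add: form_def conj_mult[symmetric] tr_conj)

lemma form_proportional:
  assumes "commutes X Y" "\<not> scalar X" "form A X = 0"
  shows "form A Y = 0"
proof -
  obtain r where "Y $ 1 $ 2 = r * X $ 1 $ 2" "Y $ 2 $ 1 = r * X $ 2 $ 1"
    "Y $ 1 $ 1 - Y $ 2 $ 2 = r * (X $ 1 $ 1 - X $ 2 $ 2)"
    using proportional_of_commutes[OF assms(1,2)] by blast
  then have "form A Y = r * form A X"
    by (subst (1) mk_eta[of A], subst mk_eta[of Y], subst (5) mk_eta[of A], subst mk_eta[of X])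
      (simp only: form_mk, simp add: algebra_simps)
  with assms(3) show ?thesis
    by simp
qed

text \<open>In a three-dimensional space with a nondegenerate form the orthogonal complement of a
  plane is a line, so the trace-free parts of \<open>A\<close> and \<open>B\<close> are multiples of
  one vector.\<close>

lemma commutes_of_orthogonal:
  fixes X Y A B :: "'a::field ^ 2 ^ 2"
  assumes two: "(2::'a) \<noteq> 0" and nc: "\<not> commutes X Y"
    and A: "form A X = 0" "form A Y = 0" and B: "form B X = 0" "form B Y = 0"
  shows "commutes A B"
proof -
  obtain x1 x2 x3 x4 where X: "X = mk x1 x2 x3 x4" by (rule mk_exhaust)
  obtain y1 y2 y3 y4 where Y: "Y = mk y1 y2 y3 y4" by (rule mk_exhaust)
  define u where "u = x1 - x4"
  define v where "v = y1 - y4"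
  \<comment> \<open>These are the coordinates of the cross product with respect to
    \<open>form\<close>, so \<open>N\<close> spans the orthogonal complement. Only the difference of
    the diagonal entries matters, so the last entry of \<open>N\<close> is set to 0.\<close>
  define n1 where "n1 = 2 * (2 * (x3 * y2 - x2 * y3))"
  define n2 where "n2 = 2 * (x2 * v - u * y2)"
  define n3 where "n3 = 2 * (u * y3 - x3 * v)"
  define N where "N = mk n1 n2 n3 0"
  have com: "commutes Z N" if "form Z X = 0" "form Z Y = 0" for Z
  proof -
    obtain z1 z2 z3 z4 where Z: "Z = mk z1 z2 z3 z4" by (rule mk_exhaust)
    define w where "w = z1 - z4"
    have fX: "w * u + 2 * (z2 * x3) + 2 * (z3 * x2) = 0"
      using that(1) by (simp only: X Z form_mk u_def w_def)
    have fY: "w * v + 2 * (z2 * y3) + 2 * (z3 * y2) = 0"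
      using that(2) by (simp only: Y Z form_mk v_def w_def)
    \<comment> \<open>The minors of \<open>Z\<close> against \<open>N\<close> are linear
      combinations of the two orthogonality relations.\<close>
    have "z2 * n3 - n2 * z3 = u * (w * v + 2 * (z2 * y3) + 2 * (z3 * y2)) -
        v * (w * u + 2 * (z2 * x3) + 2 * (z3 * x2))"
      unfolding n2_def n3_def by (simp add: algebra_simps)
    moreover have "n1 * z3 - w * n3 = 2 * x3 * (w * v + 2 * (z2 * y3) + 2 * (z3 * y2)) -
        2 * y3 * (w * u + 2 * (z2 * x3) + 2 * (z3 * x2))"
      unfolding n1_def n3_def by (simp add: algebra_simps)
    moreover have "w * n2 - n1 * z2 = 2 * x2 * (w * v + 2 * (z2 * y3) + 2 * (z3 * y2)) -
        2 * y2 * (w * u + 2 * (z2 * x3) + 2 * (z3 * x2))"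
      unfolding n1_def n2_def by (simp add: algebra_simps)
    ultimately show ?thesis
      by (simp only: fX fY Z N_def commutes_mk) (simp add: w_def)
  qed
  have "\<not> scalar N"
  proof
    assume "scalar N"
    then have "n1 = 0" "n2 = 0" "n3 = 0"
      by (auto simp: N_def)
    then have "x3 * y2 = x2 * y3" "x2 * v = u * y2" "u * y3 = x3 * v"
      using two unfolding n1_def n2_def n3_def mult_eq_0_iff by simp_all
    then have "commutes X Y"
      unfolding X Y commutes_mk by (simp add: u_def v_def mult.commute)
    with nc show False ..
  qed
  then show ?thesis
    using com[OF A] com[OF B] commutes_trans[of A N B] by simp
qed

lemma fixes_line_commutes:
  assumes "det h = 1" "\<not> scalar X" "\<not> scalar Y" "commutes X Y" "fixes_line h X"
  shows "fixes_line h Y"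
proof -
  have "commutes (conj_by h Y) (conj_by h X)"
    using assms commutes_conj[of h Y X] by simp
  then have "commutes (conj_by h Y) X"
    using assms commutes_trans scalar_conj unfolding fixes_line_def by metis
  then show ?thesis
    using assms commutes_trans unfolding fixes_line_def by metis
qed

lemma eq_of_sum_and_diff_eq:
  fixes x y x' y' :: "'a::field"
  assumes two: "(2::'a) \<noteq> 0" and "x + y = x' + y'" "x - y = x' - y'"
  shows "x = x'" and "y = y'"
proof -
  have "2 * x = (x + y) + (x - y)"
    by simp
  also have "\<dots> = (x' + y') + (x' - y')"
    by (simp only: assms(2,3))
  also have "\<dots> = 2 * x'"
    by simp
  finally show "x = x'"
    using two mult_left_cancel by blast
  with assms(2) show "y = y'"
    by simp
qed

text \<open>Conjugation by \<open>A\<close> multiplies the trace-free part of \<open>X\<close> by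
  some \<open>r\<close>. If \<open>r = 1\<close>, then \<open>X\<close> itself is fixed, as traces
  are preserved, and so commutes with \<open>A\<close>. Otherwise invariance of the form gives
  \<open>form A X = r * form A X\<close>, because \<open>A\<close> is fixed.\<close>

lemma fixed_line_or_orthogonal:
  assumes two: "(2::'a::field) \<noteq> 0" and detA: "det (A :: 'a ^ 2 ^ 2) = 1"
    and X: "\<not> scalar X" "fixes_line A X"
  shows "commutes A X \<or> form A X = 0"
proof -
  obtain r where r: "conj_by A X $ 1 $ 2 = r * X $ 1 $ 2" "conj_by A X $ 2 $ 1 = r * X $ 2 $ 1"
    "conj_by A X $ 1 $ 1 - conj_by A X $ 2 $ 2 = r * (X $ 1 $ 1 - X $ 2 $ 2)"
    using proportional_of_commutes[of X "conj_by A X"] X unfolding fixes_line_def by metis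
  show ?thesis
  proof (cases "r = 1")
    case True
    have "conj_by A X $ 1 $ 1 + conj_by A X $ 2 $ 2 = X $ 1 $ 1 + X $ 2 $ 2"
      using tr_conj[OF detA, of X] by (simp only: tr_def)
    moreover have "conj_by A X $ 1 $ 1 - conj_by A X $ 2 $ 2 = X $ 1 $ 1 - X $ 2 $ 2"
      using r(3) by (simp only: True mult_1)
    ultimately have "conj_by A X $ 1 $ 1 = X $ 1 $ 1" "conj_by A X $ 2 $ 2 = X $ 2 $ 2"
      by (rule eq_of_sum_and_diff_eq[OF two])+
    then have "conj_by A X = X"
      using r(1,2) by (simp add: True vec_eq_iff forall_2)
    then show ?thesis
      using conj_fixed_iff[OF detA] by blast
  next
    case False
    have "conj_by A A = A"
      using conj_fixed_iff[OF detA, of A] by simp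
    then have "form A X = form A (conj_by A X)"
      using form_conj[OF detA, of A X] by simp
    also have "\<dots> = r * form A X"
      using r by (subst (1) mk_eta[of A], subst (1) mk_eta[of "conj_by A X"], subst (5) mk_eta[of A], subst mk_eta[of X])
        (simp only: form_mk, simp add: algebra_simps)
    finally show ?thesis
      using False by simp
  qed
qed

text \<open>A line fixed by \<open>A\<close> is the axis of \<open>A\<close> or orthogonal to it,
  and two distinct lines orthogonal to the axis determine it.\<close>

lemma fixes_axis:
  assumes two: "(2::'a::field) \<noteq> 0" and det: "det (A :: 'a ^ 2 ^ 2) = 1" "det h = 1"
    and ns: "\<not> scalar A" "\<not> scalar X" "\<not> scalar Y" and nc: "\<not> commutes X Y"
    and fA: "fixes_line A X" "fixes_line A Y" and fh: "fixes_line h X" "fixes_line h Y"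
  shows "fixes_line h A"
proof (cases "commutes A X \<or> commutes A Y")
  case True
  then show ?thesis
    using fixes_line_commutes[OF det(2), of X A] fixes_line_commutes[OF det(2), of Y A] ns fh by auto
next
  case False
  then have A: "form A X = 0" "form A Y = 0"
    using fixed_line_or_orthogonal[OF two det(1)] ns fA by blast+
  \<comment> \<open>As \<open>h\<close> preserves the form and fixes the lines of \<open>X\<close>
    and \<open>Y\<close>, it carries \<open>A\<close> to a matrix orthogonal to both again.\<close>
  have orth: "form (conj_by h A) Z = 0" if "form A Z = 0" "fixes_line h Z" "\<not> scalar Z" for Z
  proof -
    have "form (conj_by h A) (conj_by h Z) = 0"
      using that form_conj[OF det(2)] by simp
    moreover have "commutes (conj_by h Z) Z" "\<not> scalar (conj_by h Z)"
      using that scalar_conj[OF det(2)] by (auto simp: fixes_line_def)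
    ultimately show ?thesis
      using form_proportional by blast
  qed
  have "commutes (conj_by h A) A"
    using commutes_of_orthogonal[OF two nc _ _ A] orth A fh ns by blast
  then show ?thesis
    by (simp add: fixes_line_def)
qed

section \<open>Subgroups of SL(2) without fixed lines\<close>

lemma carrier_SL2 [simp]: "A \<in> carrier SL2 \<longleftrightarrow> det A = 1"
  by (simp add: SL2_def)

lemma mult_SL2 [simp]: "A \<otimes>\<^bsub>SL2\<^esub> B = A ** B"
  by (simp add: SL2_def)

lemma one_SL2 [simp]: "\<one>\<^bsub>SL2\<^esub> = mat 1"
  by (simp add: SL2_def)

lemma inv_SL2:
  assumes "det A = 1"
  shows "inv\<^bsub>SL2\<^esub> A = adj A"
proof -
  interpret group "SL2 :: ('a ^ 2 ^ 2) monoid" by (rule group_SL2)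
  show ?thesis
    using assms by (intro inv_equality) (simp_all add: adj_mult)
qed

section \<open>Transvections and the generation of SL(2,p)\<close>

text \<open>The characteristic divides the prime order of the field and is not 1, so the natural
  numbers below that order are distinct in the field. Thus the powers of one transvection reach
  every transvection with the same axis.\<close>

lemma of_nat_surj_prime_card:
  fixes x :: "'a :: {field, finite}"
  assumes "prime (CARD('a))"
  obtains k where "x = of_nat k"
proof -
  have "CHAR('a) dvd CARD('a)"
    by (rule CHAR_dvd_CARD)
  then have "CHAR('a) = 1 \<or> CHAR('a) = CARD('a)"
    using assms by (auto simp: prime_nat_iff)
  then have "CHAR('a) = CARD('a)"
    using CHAR_not_1 by simp
  then have "inj_on (of_nat :: nat \<Rightarrow> 'a) {..<CARD('a)}"
    by (auto simp: inj_on_def of_nat_eq_iff_cong_CHAR cong_def)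
  then have "card ((of_nat :: nat \<Rightarrow> 'a) ` {..<CARD('a)}) = CARD('a)"
    by (simp add: card_image)
  then have "(of_nat :: nat \<Rightarrow> 'a) ` {..<CARD('a)} = UNIV"
    by (simp add: card_eq_UNIV_imp_eq_UNIV)
  then have "x \<in> of_nat ` {..<CARD('a)}"
    by simp
  then show ?thesis
    using that by blast
qed

text \<open>This is the Bruhat decomposition: \<open>h\<close> and the upper unitriangular matrices
  yield an antidiagonal matrix, which conjugates upper to lower unitriangular matrices, and both
  kinds together generate the group.\<close>

lemma SL2_generated_by_upper:
  fixes S :: "('a::field ^ 2 ^ 2) set"
  assumes mult: "\<And>A B. \<lbrakk>A \<in> S; B \<in> S\<rbrakk> \<Longrightarrow> A ** B \<in> S"
    and adj: "\<And>A. A \<in> S \<Longrightarrow> adj A \<in> S"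
    and upper: "\<And>t. mk 1 t 0 1 \<in> S"
    and h: "h \<in> S" "det h = 1" "h $ 2 $ 1 \<noteq> 0"
    and M: "det M = 1"
  shows "M \<in> S"
proof -
  obtain a b c d where hh: "h = mk a b c d" by (rule mk_exhaust)
  have c: "c \<noteq> 0" and deth: "a * d - b * c = 1"
    using h by (auto simp: hh)
  \<comment> \<open>A row and a column operation clear the diagonal entries of
    \<open>h\<close>.\<close>
  have "mk 1 (- a / c) 0 1 ** h ** mk 1 (- d / c) 0 1 \<in> S"
    by (intro mult upper h(1))
  moreover have "mk 1 (- a / c) 0 1 ** h ** mk 1 (- d / c) 0 1 = mk 0 (- 1 / c) c 0"
    using c deth by (simp add: hh field_simps)
  ultimately have w: "mk 0 (- 1 / c) c 0 \<in> S"
    by simp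
  have lower: "mk 1 0 t 1 \<in> S" for t
  proof -
    have "mk 0 (- 1 / c) c 0 ** mk 1 (- t / (c * c)) 0 1 ** adj (mk 0 (- 1 / c) c 0) \<in> S"
      by (intro mult upper w adj)
    moreover have "mk 0 (- 1 / c) c 0 ** mk 1 (- t / (c * c)) 0 1 ** adj (mk 0 (- 1 / c) c 0) = mk 1 0 t 1"
      using c by simp
    ultimately show ?thesis
      by simp
  qed
  have *: "mk p q r s \<in> S" if "r \<noteq> 0" "p * s - q * r = 1" for p q r s
  proof -
    have "mk 1 ((p - 1) / r) 0 1 ** mk 1 0 r 1 ** mk 1 ((s - 1) / r) 0 1 \<in> S"
      by (intro mult upper lower)
    moreover have "mk 1 ((p - 1) / r) 0 1 ** mk 1 0 r 1 ** mk 1 ((s - 1) / r) 0 1 = mk p q r s"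
      using that by (simp add: field_simps)
    ultimately show ?thesis
      by (simp only:)
  qed
  obtain p q r s where MM: "M = mk p q r s" by (rule mk_exhaust)
  have detM: "p * s - q * r = 1"
    using M by (simp add: MM)
  show ?thesis
  proof (cases "r = 0")
    case True
    \<comment> \<open>Adding the first row to the second makes the lower left entry the nonzero
      \<open>p\<close>.\<close>
    then have "mk p q p (q + s) \<in> S"
      using detM by (intro *) (auto simp: algebra_simps)
    then have "mk 1 0 (- 1) 1 ** mk p q p (q + s) \<in> S"
      by (intro mult lower)
    then show ?thesis
      by (simp add: MM True)
  next
    case False
    then show ?thesis
      using * detM by (simp add: MM)
  qed
qed

lemma unipotent_normal_form:
  assumes "det U = 1" "tr U = 2" "\<not> scalar U"
  obtains P s where "det P = 1" "s \<noteq> 0" "U = conj_by P (mk 1 s 0 1)"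
proof -
  obtain a b c d where U: "U = mk a b c d" by (rule mk_exhaust)
  have d: "d = 2 - a" and det: "a * d - b * c = 1"
    using assms by (auto simp: U algebra_simps)
  show ?thesis
  proof (cases "c = 0")
    case True
    then have "(a - 1) * (a - 1) = 0"
      using det by (simp add: d algebra_simps)
    then have "a = 1"
      by simp
    then show ?thesis
      using assms(3) True by (intro that[of "mk 1 0 0 1" b]) (simp_all add: U d conj_mk)
  next
    case False
    have "b * c = - ((a - 1) * (a - 1))"
      using det by (simp add: d algebra_simps)
    then have b: "b = - ((a - 1) * (a - 1)) / c"
      using False by (simp add: field_simps)
    \<comment> \<open>The first column of the base change is the image of the first unit vector
      under \<open>U - 1\<close>, which \<open>U\<close> fixes; the second is the multiple of that
      unit vector that makes the determinant 1.\<close>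
    show ?thesis
      using False by (intro that[of "mk (a - 1) (- 1 / c) c 0" "- 1 / c"])
        (simp_all add: U d b conj_mk field_simps)
  qed
qed

text \<open>After conjugation \<open>U\<close> is upper unitriangular, and its powers give all such
  matrices over the prime field. That \<open>h\<close> moves the line of \<open>U\<close> means that
  its conjugate has a nonzero lower left entry, so \<open>SL2_generated_by_upper\<close>
  applies.\<close>

lemma subgroup_with_unipotent:
  fixes K :: "('a::{field, finite} ^ 2 ^ 2) set"
  assumes prime: "prime (CARD('a))" and K: "subgroup K SL2"
    and U: "U \<in> K" "tr U = 2" "\<not> scalar U"
    and h: "h \<in> K" "\<not> fixes_line h U"
  shows "K = carrier SL2"
proof -
  have det: "det A = 1" if "A \<in> K" for A
    using subgroup.subset[OF K] that by auto
  obtain P s where P: "det P = 1" and s: "s \<noteq> 0" and UP: "U = conj_by P (mk 1 s 0 1)"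
    using unipotent_normal_form[OF det[OF U(1)] U(2,3)] .
  define S where "S = {M. conj_by P M \<in> K}"
  have mult: "A ** B \<in> S" if "A \<in> S" "B \<in> S" for A B
    using that subgroup.m_closed[OF K] by (simp add: S_def conj_mult[OF P])
  have conj_adj: "conj_by P (adj A) = adj (conj_by P A)" for A
    by (simp add: conj_by_def adj_prod matrix_mul_assoc)
  have adj: "adj A \<in> S" if "A \<in> S" for A
    using that subgroup.m_inv_closed[OF K, of "conj_by P A"] det[of "conj_by P A"]
    by (simp add: S_def conj_adj inv_SL2)
  have one: "mk 1 0 0 1 \<in> S"
    using subgroup.one_closed[OF K] adj_mult(2)[OF P]
    by (simp add: S_def mat_1_mk[symmetric] conj_by_def)
  have pow: "mk 1 (of_nat k * s) 0 1 \<in> S" for k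
  proof (induction k)
    case (Suc k)
    have "mk 1 s 0 1 \<in> S"
      using U(1) by (simp add: S_def UP)
    from mult[OF Suc this] show ?case
      by (simp add: algebra_simps)
  qed (simp add: one)
  have upper: "mk 1 t 0 1 \<in> S" for t
  proof -
    obtain k where "t / s = of_nat k"
      using of_nat_surj_prime_card[OF prime] .
    then have "t = of_nat k * s"
      using s by (simp add: field_simps)
    then show ?thesis
      using pow by simp
  qed
  define h' where "h' = conj_by (adj P) h"
  have hh': "h = conj_by P h'"
    using P by (simp add: h'_def)
  have h'S: "h' \<in> S"
    using h(1) by (simp add: S_def hh')
  have det_h': "det h' = 1"
    using det[OF h(1)] P by (simp add: h'_def conj_by_def det_mul)
  have "h' $ 2 $ 1 \<noteq> 0"
  proof
    assume 0: "h' $ 2 $ 1 = 0"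
    obtain a b c d where "h' = mk a b c d" by (rule mk_exhaust)
    then have "fixes_line h' (mk 1 s 0 1)"
      using 0 by (simp add: fixes_line_def conj_mk commutes_mk algebra_simps)
    moreover have "conj_by h U = conj_by P (conj_by h' (mk 1 s 0 1))"
      unfolding UP hh' conj_conj by (simp add: conj_by_def matrix_mul_assoc[symmetric])
        (simp add: adj_mult[OF P] matrix_mul_assoc)
    ultimately have "fixes_line h U"
      using commutes_conj[OF P] by (simp add: fixes_line_def UP)
    with h(2) show False ..
  qed
  then have all: "M \<in> S" if "det M = 1" for M
    using SL2_generated_by_upper[OF mult adj upper h'S det_h' _ that] by blast
  have "M \<in> K" if "det M = 1" for M
  proof -
    have "conj_by (adj P) M \<in> S"
      using that P by (intro all) (simp add: conj_by_def det_mul)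
    then show ?thesis
      using P by (simp add: S_def)
  qed
  then show ?thesis
    using det by auto
qed

section \<open>Proper subgroups without fixed line\<close>

lemma fixes_line_uminus [simp]: "fixes_line h (- X) \<longleftrightarrow> fixes_line h X"
  by (cases h rule: mk_exhaust; cases X rule: mk_exhaust)
    (simp add: fixes_line_def conj_mk commutes_mk algebra_simps)

lemma scalar_uminus [simp]: "scalar (- X) \<longleftrightarrow> scalar X"
  by (cases X rule: mk_exhaust) simp

lemma minus_mult_closed:
  assumes "subgroup K SL2" "- mat 1 \<in> K" "A \<in> K"
  shows "- A \<in> K"
  using subgroup.m_closed[OF assms] by (simp add: minus_mat_1_mult)

text \<open>For odd \<open>p\<close> the lines meant are those of the three-dimensional space of
  trace-free matrices, not those of the natural module.\<close>

definition irreducible_set :: "('a::field ^ 2 ^ 2) set \<Rightarrow> bool" where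
  "irreducible_set K \<longleftrightarrow> (\<forall>X. \<not> scalar X \<longrightarrow> (\<exists>h\<in>K. \<not> fixes_line h X))"

text \<open>If the squared trace is 4, then \<open>U\<close> or \<open>- U\<close> has trace 2. As
  some element moves its line, the subgroup would be everything.\<close>

lemma no_unipotent:
  fixes K :: "('a::{field, finite} ^ 2 ^ 2) set"
  assumes "prime (CARD('a))" "subgroup K SL2" "- mat 1 \<in> K" "irreducible_set K" "K \<noteq> carrier SL2"
    and U: "U \<in> K" "\<not> scalar U"
  shows "(tr U)\<^sup>2 \<noteq> 4"
proof
  assume "(tr U)\<^sup>2 = 4"
  then have "(tr U - 2) * (tr U + 2) = 0"
    by (simp add: power2_eq_square algebra_simps)
  then have "tr U = 2 \<or> tr U = - 2"
    by (auto simp: eq_neg_iff_add_eq_0)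
  moreover have "tr (- U) = - tr U"
    by (simp add: tr_def)
  ultimately have "tr U = 2 \<or> tr (- U) = 2"
    by auto
  moreover obtain h where h: "h \<in> K" "\<not> fixes_line h U"
    using assms(4) U by (auto simp: irreducible_set_def)
  ultimately show False
    using subgroup_with_unipotent[OF assms(1,2) U(1) _ U(2) h]
      subgroup_with_unipotent[OF assms(1,2), of "- U" h] minus_mult_closed[OF assms(2,3) U(1)]
      U h assms(5) by auto
qed

lemma scalar_SL2_iff:
  assumes "det A = 1"
  shows "scalar A \<longleftrightarrow> A = mat 1 \<or> A = - mat 1"
proof -
  obtain a b c d where A: "A = mk a b c d" by (rule mk_exhaust)
  show ?thesis
    using assms square_eq_1_iff[of a] by (auto simp: A mat_1_mk)
qed

text \<open>The trace-free part of \<open>B\<close> is \<open>r\<close> times that of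
  \<open>A\<close>, so the discriminants of the characteristic polynomials differ by the factor
  \<open>r\<^sup>2\<close>. They are equal and nonzero, hence \<open>r\<close> is 1 or -1.\<close>

lemma conj_eq_or_inverse:
  assumes two: "(2::'a::field) \<noteq> 0" and A: "det (A :: 'a ^ 2 ^ 2) = 1" "\<not> scalar A" "(tr A)\<^sup>2 \<noteq> 4"
    and B: "det B = 1" "tr B = tr A" "commutes B A"
  shows "B = A \<or> B = adj A"
proof -
  obtain a b c d where AA: "A = mk a b c d" by (rule mk_exhaust)
  obtain a' b' c' d' where BB: "B = mk a' b' c' d'" by (rule mk_exhaust)
  obtain r where r: "b' = r * b" "c' = r * c" "a' - d' = r * (a - d)"
    using proportional_of_commutes[of A B] A(2) B(3) by (auto simp: AA BB)
  define D where "D = (a - d)\<^sup>2 + 4 * (b * c)"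
  have D: "D = (tr A)\<^sup>2 - 4 * det A"
    by (simp add: D_def AA power2_eq_square algebra_simps)
  have "(a' - d')\<^sup>2 + 4 * (b' * c') = (tr B)\<^sup>2 - 4 * det B"
    by (simp add: BB power2_eq_square algebra_simps)
  also have "\<dots> = D"
    using A B by (simp add: D)
  finally have "r\<^sup>2 * D = D"
    unfolding r D_def by (simp add: power2_eq_square algebra_simps)
  moreover have "D \<noteq> 0"
    using A by (simp add: D)
  ultimately have "r = 1 \<or> r = - 1"
    by (simp add: power2_eq_1_iff)
  have sum: "a' + d' = a + d"
    using B(2) by (simp add: AA BB)
  from \<open>r = 1 \<or> r = - 1\<close> show ?thesis
  proof
    assume "r = 1"
    then have "a' = a"
      using eq_of_sum_and_diff_eq(1)[OF two sum] r(3) by simp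
    then show ?thesis
      using sum r \<open>r = 1\<close> by (simp add: AA BB)
  next
    assume "r = - 1"
    then have "a' = d"
      using eq_of_sum_and_diff_eq(1)[OF two, of a' d' d a] sum r(3) by (simp add: add.commute)
    then show ?thesis
      using sum r \<open>r = - 1\<close> by (simp add: AA BB add.commute)
  qed
qed

lemma involution_SL2:
  assumes two: "(2::'a::field) \<noteq> 0" and A: "det (A :: 'a ^ 2 ^ 2) = 1" "A ** A = mat 1"
  shows "scalar A"
proof -
  have "adj A ** (A ** A) = A"
    using adj_mult(1)[OF A(1)] by (simp add: matrix_mul_assoc)
  then have "A = adj A"
    using A(2) by simp
  obtain a b c d where AA: "A = mk a b c d" by (rule mk_exhaust)
  have eqs: "b = - b" "c = - c" "a = d"
    using \<open>A = adj A\<close> unfolding AA adj_mk mk_eq_iff by blast+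
  have zero: "x = 0" if "x = - x" for x :: 'a
  proof -
    have "2 * x = 0"
      using that by (metis add.right_inverse mult_2)
    then show ?thesis
      using two by simp
  qed
  show ?thesis
    using zero[OF eqs(1)] zero[OF eqs(2)] eqs(3) by (simp add: AA)
qed

text \<open>The absence of elements with squared trace 4 enters through the last axiom, where it
  makes the discriminant nonzero in \<open>conj_eq_or_inverse\<close>.\<close>

lemma commuting_transitive_SL2_subgroup:
  fixes K :: "('a::{field, finite} ^ 2 ^ 2) set"
  assumes prime: "prime (CARD('a))" and two: "(2::'a) \<noteq> 0" and K: "subgroup K SL2" "- mat 1 \<in> K"
    and irr: "irreducible_set K" and proper: "K \<noteq> carrier SL2"
  shows "commuting_transitive_group (SL2\<lparr>carrier := K\<rparr>) (- mat 1)"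
    and "commuting_transitive_group.irreducible_group (SL2\<lparr>carrier := K\<rparr>) (- mat 1)"
proof -
  interpret SL: group "SL2 :: ('a ^ 2 ^ 2) monoid" by (rule group_SL2)
  interpret KG: group "SL2\<lparr>carrier := K\<rparr>"
    by (rule SL.subgroup_imp_group[OF K(1)])
  have det: "det A = 1" if "A \<in> K" for A
    using subgroup.subset[OF K(1)] that by auto
  have inv: "inv\<^bsub>SL2\<lparr>carrier := K\<rparr>\<^esub> A = adj A" if "A \<in> K" for A
    using SL.m_inv_consistent[OF K(1) that] inv_SL2[OF det[OF that]] by simp
  have nonscalar: "A \<in> K \<and> A \<notin> {mat 1, - mat 1} \<longleftrightarrow> A \<in> K \<and> \<not> scalar A" for A
    using scalar_SL2_iff[of A] det by blast
  have neq: "- mat 1 \<noteq> (mat 1 :: 'a ^ 2 ^ 2)"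
    using two by (simp add: mat_1_mk)
  interpret C: commuting_transitive_group "SL2\<lparr>carrier := K\<rparr>" "- mat 1"
  proof unfold_locales
    fix x assume "x \<in> carrier (SL2\<lparr>carrier := K\<rparr>)"
      and "x \<otimes>\<^bsub>SL2\<lparr>carrier := K\<rparr>\<^esub> x = \<one>\<^bsub>SL2\<lparr>carrier := K\<rparr>\<^esub>"
    then show "x \<in> {\<one>\<^bsub>SL2\<lparr>carrier := K\<rparr>\<^esub>, - mat 1}"
      using involution_SL2[OF two det, of x] nonscalar[of x] by simp
  next
    fix a b c
    assume "a \<in> carrier (SL2\<lparr>carrier := K\<rparr>) - {\<one>\<^bsub>SL2\<lparr>carrier := K\<rparr>\<^esub>, - mat 1}"
      and "b \<in> carrier (SL2\<lparr>carrier := K\<rparr>) - {\<one>\<^bsub>SL2\<lparr>carrier := K\<rparr>\<^esub>, - mat 1}"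
      and "c \<in> carrier (SL2\<lparr>carrier := K\<rparr>) - {\<one>\<^bsub>SL2\<lparr>carrier := K\<rparr>\<^esub>, - mat 1}"
      and "a \<otimes>\<^bsub>SL2\<lparr>carrier := K\<rparr>\<^esub> b = b \<otimes>\<^bsub>SL2\<lparr>carrier := K\<rparr>\<^esub> a"
      and "b \<otimes>\<^bsub>SL2\<lparr>carrier := K\<rparr>\<^esub> c = c \<otimes>\<^bsub>SL2\<lparr>carrier := K\<rparr>\<^esub> b"
    then show "a \<otimes>\<^bsub>SL2\<lparr>carrier := K\<rparr>\<^esub> c = c \<otimes>\<^bsub>SL2\<lparr>carrier := K\<rparr>\<^esub> a"
      using commutes_trans[of a b c] nonscalar[of b] by simp
  next
    fix a x
    assume a: "a \<in> carrier (SL2\<lparr>carrier := K\<rparr>) - {\<one>\<^bsub>SL2\<lparr>carrier := K\<rparr>\<^esub>, - mat 1}"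
      and x: "x \<in> carrier (SL2\<lparr>carrier := K\<rparr>)"
      and com: "(x \<otimes>\<^bsub>SL2\<lparr>carrier := K\<rparr>\<^esub> a \<otimes>\<^bsub>SL2\<lparr>carrier := K\<rparr>\<^esub> inv\<^bsub>SL2\<lparr>carrier := K\<rparr>\<^esub> x)
          \<otimes>\<^bsub>SL2\<lparr>carrier := K\<rparr>\<^esub> a =
        a \<otimes>\<^bsub>SL2\<lparr>carrier := K\<rparr>\<^esub>
          (x \<otimes>\<^bsub>SL2\<lparr>carrier := K\<rparr>\<^esub> a \<otimes>\<^bsub>SL2\<lparr>carrier := K\<rparr>\<^esub> inv\<^bsub>SL2\<lparr>carrier := K\<rparr>\<^esub> x)"
    have aK: "a \<in> K" and xK: "x \<in> K" and ns: "\<not> scalar a"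
      using a x nonscalar[of a] by auto
    have "commutes (conj_by x a) a"
      using com xK by (simp add: inv conj_by_def)
    moreover have "det (conj_by x a) = 1" "tr (conj_by x a) = tr a"
      using det aK xK by (simp_all add: conj_by_def det_mul tr_conj[unfolded conj_by_def])
    ultimately have "conj_by x a = a \<or> conj_by x a = adj a"
      using conj_eq_or_inverse[OF two det[OF aK] ns] no_unipotent[OF prime K irr proper aK ns] by blast
    then show "x \<otimes>\<^bsub>SL2\<lparr>carrier := K\<rparr>\<^esub> a \<otimes>\<^bsub>SL2\<lparr>carrier := K\<rparr>\<^esub> inv\<^bsub>SL2\<lparr>carrier := K\<rparr>\<^esub> x
        \<in> {a, inv\<^bsub>SL2\<lparr>carrier := K\<rparr>\<^esub> a}"
      using aK xK by (simp add: inv conj_by_def)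
  qed (use K neq in \<open>auto simp: minus_mat_1_mult\<close>)
  show "commuting_transitive_group (SL2\<lparr>carrier := K\<rparr>) (- mat 1)"
    by unfold_locales
  have "\<not> K \<subseteq> {mat 1, - mat 1}"
  proof
    assume sub: "K \<subseteq> {mat 1, - mat 1}"
    \<comment> \<open>Central matrices fix every line, so any non-scalar matrix would serve as the
      witness.\<close>
    have "fixes_line h (mk 0 1 0 0)" if "h \<in> K" for h :: "'a ^ 2 ^ 2"
      using sub that by (auto simp: fixes_line_def mat_1_mk conj_mk)
    moreover have "\<not> scalar (mk 0 1 0 (0::'a))"
      by simp
    ultimately show False
      using irr unfolding irreducible_set_def by blast
  qed
  moreover have "C.line_stab a \<noteq> K" if a: "a \<in> K" "\<not> scalar a" for a
  proof -
    obtain h where h: "h \<in> K" "\<not> fixes_line h a"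
      using irr a by (auto simp: irreducible_set_def)
    then have "h \<notin> C.line_stab a"
      by (simp add: C.line_stab_def C.cj_def inv fixes_line_def conj_by_def)
    with h(1) show ?thesis
      by blast
  qed
  ultimately show C.irreducible_group
    using nonscalar by (auto simp: C.irreducible_group_def)
qed

section \<open>Common fixed lines of generators\<close>

lemma subgroup_fixing_line:
  assumes "\<not> scalar (X :: 'a::field ^ 2 ^ 2)"
  shows "subgroup {h. det h = 1 \<and> fixes_line h X} SL2"
proof -
  interpret group "SL2 :: ('a ^ 2 ^ 2) monoid" by (rule group_SL2)
  show ?thesis
  proof (rule subgroupI)
    show "{h. det h = 1 \<and> fixes_line h X} \<noteq> {}"
      by (auto simp: fixes_line_def intro: exI[of _ "mat 1"])
  next
    fix h :: "'a ^ 2 ^ 2" assume h: "h \<in> {h. det h = 1 \<and> fixes_line h X}"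
    then have "commutes (conj_by (adj h) (conj_by h X)) (conj_by (adj h) X)"
      using commutes_conj[of "adj h" "conj_by h X" X] by (simp add: fixes_line_def)
    then show "inv\<^bsub>SL2\<^esub> h \<in> {h. det h = 1 \<and> fixes_line h X}"
      using h by (simp add: fixes_line_def inv_SL2)
  next
    fix g h :: "'a ^ 2 ^ 2"
    assume g: "g \<in> {h. det h = 1 \<and> fixes_line h X}" and h: "h \<in> {h. det h = 1 \<and> fixes_line h X}"
    then have "commutes (conj_by g (conj_by h X)) (conj_by g X)" "commutes (conj_by g X) X"
      using commutes_conj[of g "conj_by h X" X] by (auto simp: fixes_line_def)
    moreover have "\<not> scalar (conj_by g X)"
      using assms g by (simp add: scalar_conj)
    ultimately have "commutes (conj_by g (conj_by h X)) X"
      using commutes_trans by blast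
    then show "g \<otimes>\<^bsub>SL2\<^esub> h \<in> {h. det h = 1 \<and> fixes_line h X}"
      using g h by (simp add: fixes_line_def conj_conj det_mul)
  qed auto
qed

lemma fixes_line_minus_one: "fixes_line (- mat 1) X"
  by (cases X rule: mk_exhaust) (simp add: fixes_line_def mat_1_mk conj_mk)

text \<open>The stabilizer of a line is a subgroup, so fixing a line can be tested on
  generators.\<close>

lemma irreducible_generate_iff:
  fixes T :: "('a::field ^ 2 ^ 2) set"
  assumes T: "T \<subseteq> carrier SL2"
  shows "irreducible_set (generate SL2 T) \<longleftrightarrow> irreducible_set T"
proof -
  interpret group "SL2 :: ('a ^ 2 ^ 2) monoid" by (rule group_SL2)
  have "\<forall>h\<in>generate SL2 T. fixes_line h X" if "\<not> scalar X" "\<forall>h\<in>T. fixes_line h X" for X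
  proof -
    have "T \<subseteq> {h. det h = 1 \<and> fixes_line h X}"
      using that T by auto
    then show ?thesis
      using generate_subgroup_incl[OF _ subgroup_fixing_line[OF that(1)]] by blast
  qed
  moreover have "T \<subseteq> generate SL2 T"
    by (auto intro: generate.incl)
  ultimately show ?thesis
    unfolding irreducible_set_def by blast
qed

text \<open>The upper transvection fixes only its own axis, and the lower one does not fix that
  line.\<close>

lemma irreducible_SL2:
  assumes two: "(2::'a::field) \<noteq> 0"
  shows "irreducible_set (carrier (SL2 :: ('a ^ 2 ^ 2) monoid))"
  unfolding irreducible_set_def
proof (intro allI impI)
  fix X :: "'a ^ 2 ^ 2" assume ns: "\<not> scalar X"
  obtain a b c d where X: "X = mk a b c d" by (rule mk_exhaust)
  have U: "c = 0 \<and> a = d" if "fixes_line (mk 1 1 0 1) X"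
  proof -
    have 1: "(a + c - (d - c)) * c = (a - d) * c"
      and 2: "(a + c - (d - c)) * b = (a - d) * (b + d - (a + c))"
      using that unfolding fixes_line_def X conj_mk commutes_mk by simp_all
    from 1 have "2 * (c * c) = 0"
      by (simp add: algebra_simps)
    then have "c = 0"
      using two by simp
    moreover from this 2 have "(a - d) * (a - d) = 0"
      by (simp add: algebra_simps)
    ultimately show ?thesis
      by simp
  qed
  have L: "b = 0" if "fixes_line (mk 1 0 1 1) X"
  proof -
    have "(a - b - (b + d)) * b = (a - d) * b"
      using that unfolding fixes_line_def X conj_mk commutes_mk by simp
    then have "2 * (b * b) = 0"
      by (simp add: algebra_simps)
    then show ?thesis
      using two by simp
  qed
  have "\<not> (fixes_line (mk 1 1 0 1) X \<and> fixes_line (mk 1 0 1 1) X)"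
    using U L ns by (auto simp: X)
  moreover have "mk 1 1 0 (1::'a) \<in> carrier SL2" "mk 1 0 1 (1::'a) \<in> carrier SL2"
    by simp_all
  ultimately show "\<exists>h\<in>carrier SL2. \<not> fixes_line h X"
    by blast
qed

text \<open>For each \<open>i\<close> let \<open>X i\<close> be fixed by \<open>A\<close> and all
  \<open>a j\<close> with \<open>j \<noteq> i\<close>. If two of these lines coincide, that line is
  fixed by everything. Otherwise each \<open>a k\<close> fixes two distinct lines fixed by
  \<open>A\<close>, as two indices other than \<open>k\<close> remain, and \<open>fixes_axis\<close>
  makes the axis of \<open>A\<close> the common line.\<close>

lemma common_fixed_line:
  fixes A :: "'a::field ^ 2 ^ 2" and a :: "'i \<Rightarrow> 'a ^ 2 ^ 2"
  assumes two: "(2::'a) \<noteq> 0" and A: "det A = 1" "\<not> scalar A"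
    and a: "\<And>i. i \<in> I \<Longrightarrow> det (a i) = 1" and I: "3 \<le> card I"
    and red: "\<And>i. i \<in> I \<Longrightarrow> \<not> irreducible_set (insert A (a ` (I - {i})))"
  shows "\<not> irreducible_set (insert A (a ` I))"
proof -
  have "\<exists>X. \<not> scalar X \<and> fixes_line A X \<and> (\<forall>j\<in>I - {i}. fixes_line (a j) X)" if "i \<in> I" for i
    using red[OF that] unfolding irreducible_set_def by auto
  then obtain X where X: "\<And>i. i \<in> I \<Longrightarrow> \<not> scalar (X i)" "\<And>i. i \<in> I \<Longrightarrow> fixes_line A (X i)"
    "\<And>i j. \<lbrakk>i \<in> I; j \<in> I; j \<noteq> i\<rbrakk> \<Longrightarrow> fixes_line (a j) (X i)"
    by (metis Diff_iff empty_iff insert_iff)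
  have "\<exists>Y. \<not> scalar Y \<and> fixes_line A Y \<and> (\<forall>j\<in>I. fixes_line (a j) Y)"
  proof (cases "\<exists>i\<in>I. \<exists>j\<in>I. i \<noteq> j \<and> commutes (X i) (X j)")
    case True
    then obtain i j where ij: "i \<in> I" "j \<in> I" "i \<noteq> j" "commutes (X j) (X i)"
      by metis
    have "fixes_line (a i) (X i)"
      using fixes_line_commutes[OF a[OF ij(1)] X(1)[OF ij(2)] X(1)[OF ij(1)] ij(4)] X(3) ij by blast
    then have "\<forall>k\<in>I. fixes_line (a k) (X i)"
      using X(3) ij(1) by metis
    then show ?thesis
      using X(1,2) ij(1) by blast
  next
    case False
    have "fixes_line (a k) A" if k: "k \<in> I" for k
    proof -
      have "finite I"
        using I card.infinite by fastforce
      then have "2 \<le> card (I - {k})"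
        using I k by (simp add: card_Diff_singleton)
      then obtain i j where ij: "i \<in> I" "j \<in> I" "i \<noteq> k" "j \<noteq> k" "i \<noteq> j"
        by (metis Diff_iff card_le_Suc0_iff_eq card.infinite insertI1 not_less_eq_eq numeral_2_eq_2 le_zero_eq nat.distinct(1))
      then show ?thesis
        using fixes_axis[OF two A(1) a[OF k] A(2), of "X i" "X j"] X k False by metis
    qed
    moreover have "fixes_line A A"
      using conj_fixed_iff[OF A(1), of A] by (simp add: fixes_line_def)
    ultimately show ?thesis
      using A(2) by blast
  qed
  then show ?thesis
    unfolding irreducible_set_def by blast
qed

lemma irreducible_set_minus_one:
  "irreducible_set (insert (- mat 1) T) \<longleftrightarrow> irreducible_set T"
  unfolding irreducible_set_def using fixes_line_minus_one by blast

section \<open>The contradiction inside SL(2,p)\<close>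

text \<open>In the application \<open>S i\<close> is the preimage of the subgroup generated after
  the replacement at position \<open>i\<close>, \<open>A\<close> lifts the replacing element and the
  \<open>a i\<close> lift the generators. Including \<open>- mat 1\<close> makes generation in
  \<open>SL2\<close> match generation modulo the centre.\<close>

lemma proper_subgroups_meet_in_center:
  fixes A :: "'a::{field, finite} ^ 2 ^ 2" and a :: "nat \<Rightarrow> 'a ^ 2 ^ 2"
  assumes prime: "prime (CARD('a))"
    and S: "\<And>i. i < 4 \<Longrightarrow> subgroup (S i) SL2" "\<And>i. i < 4 \<Longrightarrow> - mat 1 \<in> S i"
      "\<And>i. i < 4 \<Longrightarrow> S i \<noteq> carrier SL2"
    and A_mem: "\<And>i. i < 4 \<Longrightarrow> A \<in> S i"
    and a: "\<And>i j. \<lbrakk>i < 4; j < 4; i \<noteq> j\<rbrakk> \<Longrightarrow> a j \<in> S i"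
    and gen: "\<And>T. \<lbrakk>subgroup T SL2; - mat 1 \<in> T; \<And>i. i < 4 \<Longrightarrow> a i \<in> T\<rbrakk> \<Longrightarrow> T = carrier SL2"
  shows "A = mat 1 \<or> A = - mat 1"
proof (rule ccontr)
  assume "\<not> (A = mat 1 \<or> A = - mat 1)"
  with A_mem have A: "\<And>i. i < 4 \<Longrightarrow> A \<in> S i" "A \<noteq> mat 1" "A \<noteq> - mat 1"
    by blast+
  interpret SL: group "SL2 :: ('a ^ 2 ^ 2) monoid" by (rule group_SL2)
  have fin: "finite (carrier (SL2 :: ('a ^ 2 ^ 2) monoid))"
    by simp
  have detA: "det A = 1"
    using A(1)[of 0] subgroup.subset[OF S(1)[of 0]] by auto
  have deta: "det (a j) = 1" if "j < 4" for j
  proof -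
    obtain i :: nat where "i < 4" "i \<noteq> j"
      by (metis zero_less_numeral one_less_numeral_iff semiring_norm(76) zero_neq_one)
    then show ?thesis
      using a[of i j] that subgroup.subset[OF S(1)[of i]] by auto
  qed
  define I :: "nat set" where "I = {..<4}"
  define gens where "gens J = insert (- mat 1) (insert A (a ` J))" for J
  define K where "K J = generate SL2 (gens J)" for J
  have gens: "gens J \<subseteq> carrier SL2" if "J \<subseteq> I" for J
    using that detA deta by (auto simp: gens_def I_def det_2 mat_def)
  have K: "subgroup (K J) SL2" if "J \<subseteq> I" for J
    unfolding K_def by (rule SL.generate_is_subgroup[OF gens[OF that]])
  have gens_K: "gens J \<subseteq> K J" for J
    by (auto simp: K_def intro: generate.incl)
  have K_mono: "K J \<subseteq> K J'" if "J \<subseteq> J'" for J J'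
    unfolding K_def by (rule SL.mono_generate) (use that in \<open>auto simp: gens_def\<close>)
  \<comment> \<open>The group \<open>K J\<close> lies in \<open>S i\<close>, which already contains
    every other generator; with \<open>a i\<close> it would be the whole group.\<close>
  have a_K: "a i \<notin> K J" if "i \<in> I" "J \<subseteq> I - {i}" for i J
  proof
    assume "a i \<in> K J"
    have i: "i < 4"
      using that by (simp add: I_def)
    have "gens J \<subseteq> S i"
      using that i S(2)[OF i] A(1)[OF i] a[OF i] by (auto simp: gens_def I_def subset_iff)
    then have "K J \<subseteq> S i"
      unfolding K_def by (rule SL.generate_subgroup_incl[OF _ S(1)[OF i]])
    with \<open>a i \<in> K J\<close> have "a j \<in> S i" if "j < 4" for j
      using a[OF i that] by (cases "j = i") auto
    then have "S i = carrier SL2"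
      using gen[OF S(1)[OF i] S(2)[OF i]] by blast
    with S(3)[OF i] show False ..
  qed
  have K_strict: "K J \<subset> K J'" if JJ': "J \<subseteq> I" "J' \<subseteq> I" "J \<subset> J'" for J J'
  proof -
    obtain i where "i \<in> J'" "i \<notin> J"
      using JJ' by blast
    then have "a i \<in> K J'" "a i \<notin> K J"
      using gens_K[of J'] a_K[of i J] JJ' by (auto simp: gens_def)
    then show ?thesis
      using K_mono[of J J'] JJ' by blast
  qed
  have proper: "K (I - {i}) \<noteq> carrier SL2" if "i \<in> I" for i
  proof -
    have "a i \<notin> K (I - {i})" "a i \<in> carrier SL2"
      using a_K[OF that subset_refl] deta[of i] that by (simp_all add: I_def)
    then show ?thesis
      by metis
  qed
  have K_I: "K I = carrier SL2"
    using gens_K[of I] by (intro gen K) (auto simp: gens_def I_def)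
  \<comment> \<open>For \<open>p = 2\<close> the chain from the trivial group through
    \<open>K {}\<close>, \<open>K {0}\<close> and \<open>K {0, 1}\<close> to
    \<open>K {0, 1, 2}\<close> doubles the order four times. That gives 16 elements, the number of
    all matrices, although the zero matrix is missing.\<close>
  have two: "(2::'a) \<noteq> 0"
  proof
    assume "(2::'a) = 0"
    have "CHAR('a) dvd CARD('a)"
      by (rule CHAR_dvd_CARD)
    then have "CARD('a) = CHAR('a)"
      using prime CHAR_not_1 by (auto simp: prime_nat_iff)
    moreover have "of_nat 2 = (0::'a)"
      using \<open>(2::'a) = 0\<close> by simp
    ultimately have "CARD('a) dvd 2"
      unfolding of_nat_eq_0_iff_char_dvd by simp
    then have "CARD('a) = 2"
      using prime primes_dvd_imp_eq two_is_prime_nat by blast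
    then have card: "CARD('a ^ 2 ^ 2) = 16"
      by simp
    have "{mat 1} \<subset> K {}"
      using gens_K[of "{}"] A subgroup.one_closed[OF K[of "{}"]] by (auto simp: gens_def)
    then have "2 \<le> card (K {})"
      using SL.double_card_subgroup_le[OF fin SL.triv_subgroup K[of "{}"]] by simp
    moreover have "{0, Suc 0} \<noteq> {0, Suc 0, 2}"
      by (metis insertI1 insert_commute insert_iff numeral_2_eq_2 old.nat.distinct(1) nat.inject singletonD)
    moreover have "2 * card (K J) \<le> card (K J')" if "J \<subseteq> I" "J' \<subseteq> I" "J \<subset> J'" for J J'
      using SL.double_card_subgroup_le[OF fin K K K_strict] that by blast
    from this[of "{}" "{0}"] this[of "{0}" "{0, 1}"] this[of "{0, 1}" "{0, 1, 2}"]
    have "2 * card (K {}) \<le> card (K {0})" "2 * card (K {0}) \<le> card (K {0, 1})"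
      "2 * card (K {0, 1}) \<le> card (K {0, 1, 2})"
      using \<open>{0, Suc 0} \<noteq> {0, Suc 0, 2}\<close> by (simp_all add: I_def psubset_eq)
    ultimately have "16 \<le> card (K {0, 1, 2})"
      by linarith
    moreover have "0 \<notin> K {0, 1, 2}"
      using subgroup.subset[OF K[of "{0, 1, 2}"]] by (auto simp: I_def det_2)
    then have "card (K {0, 1, 2}) < CARD('a ^ 2 ^ 2)"
      by (intro psubset_card_mono) auto
    ultimately show False
      using card by simp
  qed
  have irr_iff: "irreducible_set (K J) \<longleftrightarrow> irreducible_set (insert A (a ` J))" if "J \<subseteq> I" for J
    unfolding K_def irreducible_generate_iff[OF gens[OF that]]
    unfolding gens_def irreducible_set_minus_one ..
  have nsA: "\<not> scalar A"
    using A scalar_SL2_iff[OF detA] by blast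
  have step: "\<exists>i\<in>J. irreducible_set (K (J - {i}))" if "J \<subseteq> I" "3 \<le> card J" "irreducible_set (K J)" for J
  proof (rule ccontr)
    assume "\<not> (\<exists>i\<in>J. irreducible_set (K (J - {i})))"
    then have "\<not> irreducible_set (insert A (a ` (J - {i})))" if "i \<in> J" for i
      using irr_iff[of "J - {i}"] that \<open>J \<subseteq> I\<close> by blast
    then have "\<not> irreducible_set (insert A (a ` J))"
      using common_fixed_line[OF two detA nsA _ that(2)] deta that(1) by (auto simp: I_def)
    with that irr_iff[OF that(1)] show False
      by blast
  qed
  have cardI: "card I = 4"
    by (simp add: I_def)
  obtain i where i: "i \<in> I" "irreducible_set (K (I - {i}))"
    using step[of I] K_I irreducible_SL2[OF two] cardI by auto
  have card3: "card (I - {i}) = 3"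
    using i cardI by simp
  obtain j where j: "j \<in> I - {i}" "irreducible_set (K (I - {i} - {j}))"
    using step[OF _ _ i(2)] card3 by auto
  have "card (I - {i} - {j}) = 2"
    using j card3 by simp
  then obtain k l where kl: "I - {i} - {j} = {k, l}" "k \<noteq> l"
    by (auto simp: card_2_iff)
  define K1 where "K1 = K (I - {i})"
  define K2 where "K2 = K {k, l}"
  have klI: "k \<in> I" "l \<in> I" "{k, l} \<subseteq> I"
    using kl by auto
  have K1: "subgroup K1 SL2" "- mat 1 \<in> K1" "irreducible_set K1" "K1 \<noteq> carrier SL2"
    using K[of "I - {i}"] gens_K[of "I - {i}"] i proper by (auto simp: K1_def gens_def)
  have ss: "K2 \<subset> K1"
    unfolding K1_def K2_def using kl j by (intro K_strict) auto
  have K2: "subgroup K2 SL2" "- mat 1 \<in> K2" "irreducible_set K2" "K2 \<noteq> carrier SL2"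
    using K[of "{k, l}"] gens_K[of "{k, l}"] j kl ss subgroup.subset[OF K1(1)]
    by (auto simp: K2_def gens_def)
  have ord1: "card K1 \<in> {24, 48, 120}"
    using commuting_transitive_group.irreducible_order[OF commuting_transitive_SL2_subgroup[OF prime two K1]]
    by (simp add: order_def)
  have ord2: "card K2 \<in> {24, 48, 120}"
    using commuting_transitive_group.irreducible_order[OF commuting_transitive_SL2_subgroup[OF prime two K2]]
    by (simp add: order_def)
  have "card K2 dvd card K1" "2 * card K2 \<le> card K1"
    using SL.card_subgroup_dvd[OF K2(1) K1(1)] SL.double_card_subgroup_le[OF fin K2(1) K1(1)] ss by auto
  \<comment> \<open>Among the three possible orders 48 does not divide 120, so a proper divisor must
    be 24.\<close>
  then have "card K2 = 24"
    using ord1 ord2 by auto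
  then have ord24: "order (SL2\<lparr>carrier := K2\<rparr>) = 24"
    by (simp add: order_def)
  have sub: "subgroup (K {m}) (SL2\<lparr>carrier := K2\<rparr>)" if "m \<in> {k, l}" for m
    using that K[of "{m}"] K_mono[of "{m}" "{k, l}"] klI
    by (intro SL.subgroup_incl K2(1)) (auto simp: K2_def)
  have mem: "- mat 1 \<in> K {m}" "A \<in> K {m}" "a m \<in> K {m}" for m
    using gens_K[of "{m}"] by (auto simp: gens_def)
  have "A \<in> K2"
    using gens_K[of "{k, l}"] by (auto simp: K2_def gens_def)
  \<comment> \<open>Both groups contain the noncentral \<open>A\<close>, yet neither contains the
    generator of the other.\<close>
  then have "K {k} \<subseteq> K {l} \<or> K {l} \<subseteq> K {k}"
    using A(2,3)
    by (intro commuting_transitive_group.comparable_subgroups_order_24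
        [OF commuting_transitive_SL2_subgroup[OF prime two K2] ord24 sub sub mem(1) mem(1) mem(2) mem(2)]) auto
  moreover have "a k \<notin> K {l}" "a l \<notin> K {k}"
    using a_K[of k "{l}"] a_K[of l "{k}"] kl klI by auto
  ultimately show False
    using mem(3) by blast
qed

section \<open>Lifting from PSL(2,p) to SL(2,p)\<close>

theorem corollary17:
  fixes p :: nat and G :: "('a::{field, finite} ^ 2 ^ 2) set monoid"
  assumes "prime p" and "CARD('a) = p"
    and "G = PSL2"
    and "max_irredundant_length G = 4"
  shows "replacement_property G"
  unfolding replacement_property_def replacement_property_for_def
proof (intro allI impI ballI)
  fix s g
  assume "irredundant_generating_seq G s \<and> length s = max_irredundant_length G"
    and gG: "g \<in> carrier G" and g1: "g \<noteq> \<one>\<^bsub>G\<^esub>"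
  then have s: "set s \<subseteq> carrier G" "generate G (set s) = carrier G" and len: "length s = 4"
    using assms(4) by (auto simp: irredundant_generating_seq_def generating_seq_def)
  interpret Z: normal "{mat 1, - mat 1}" "SL2 :: ('a ^ 2 ^ 2) monoid" by (rule normal_SL2)
  interpret G: group G unfolding assms(3) by (rule group_PSL2)
  define \<phi> :: "'a ^ 2 ^ 2 \<Rightarrow> ('a ^ 2 ^ 2) set" where "\<phi> = (\<lambda>M. {mat 1, - mat 1} #>\<^bsub>SL2\<^esub> M)"
  have \<phi>: "\<phi> M = {M, - M}" for M
    by (auto simp: \<phi>_def r_coset_def minus_mat_1_mult)
  have one_G: "\<one>\<^bsub>G\<^esub> = {mat 1, - mat 1}"
    by (simp add: assms(3) PSL2_def)
  interpret \<phi>: group_hom SL2 G \<phi>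
    using Z.r_coset_hom_Mod by (unfold_locales) (simp add: assms(3) PSL2_def \<phi>_def)
  have onto: "carrier G = \<phi> ` carrier SL2"
    by (simp add: assms(3) PSL2_def carrier_FactGroup \<phi>_def)
  show "\<exists>i<length s. generating_seq G (s[i := g])"
  proof (rule ccontr)
    assume none: "\<not> (\<exists>i<length s. generating_seq G (s[i := g]))"
    have "\<exists>M. det M = 1 \<and> \<phi> M = s ! i" if "i < 4" for i
    proof -
      have "s ! i \<in> \<phi> ` carrier SL2"
        using s(1) len that onto by (metis nth_mem subsetD)
      then show ?thesis
        by auto
    qed
    then obtain a where a: "\<And>i. i < 4 \<Longrightarrow> det (a i) = 1" "\<And>i. i < 4 \<Longrightarrow> \<phi> (a i) = s ! i"
      by metis
    obtain A where A: "det A = 1" "\<phi> A = g"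
      using gG onto by auto
    define H where "H i = generate G (set (s[i := g]))" for i
    have set_upd: "set (s[i := g]) \<subseteq> carrier G" for i
      using s(1) gG set_update_subset_insert by fastforce
    have H: "subgroup (H i) G" for i
      unfolding H_def by (rule G.generate_is_subgroup[OF set_upd])
    define S where "S i = {M. det M = 1 \<and> \<phi> M \<in> H i}" for i
    have S: "subgroup (S i) SL2" for i
    proof (rule Z.subgroupI)
      show "S i \<noteq> {}"
        using \<phi>.hom_one subgroup.one_closed[OF H] by (auto simp: S_def intro!: exI[of _ "mat 1"])
      show "inv\<^bsub>SL2\<^esub> M \<in> S i" if "M \<in> S i" for M
        using that \<phi>.hom_inv[of M] subgroup.m_inv_closed[OF H] by (simp add: S_def inv_SL2)
      show "M \<otimes>\<^bsub>SL2\<^esub> N \<in> S i" if "M \<in> S i" "N \<in> S i" for M N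
        using that \<phi>.hom_mult[of M N] subgroup.m_closed[OF H] by (simp add: S_def det_mul)
    qed (auto simp: S_def)
    have "A = mat 1 \<or> A = - mat 1"
    proof (rule proper_subgroups_meet_in_center[of S A a])
      show "prime (CARD('a))"
        using assms by simp
      show "subgroup (S i) SL2" for i
        by (rule S)
      show "- mat 1 \<in> S i" for i
        using subgroup.one_closed[OF H, of i] by (simp add: S_def \<phi> one_G insert_commute det_2 mat_def)
      show "S i \<noteq> carrier SL2" if "i < 4" for i
      proof
        assume "S i = carrier SL2"
        then have "carrier G \<subseteq> H i"
          by (auto simp: onto S_def)
        then have "generating_seq G (s[i := g])"
          using set_upd[of i] subgroup.subset[OF H[of i]] by (simp add: generating_seq_def H_def)
        with none that len show False
          by simp
      qed
      show "A \<in> S i" if "i < 4" for i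
        using A that len by (auto simp: S_def H_def set_update_memI intro!: generate.incl)
      show "a j \<in> S i" if "i < 4" "j < 4" "i \<noteq> j" for i j
      proof -
        have "s[i := g] ! j \<in> set (s[i := g])"
          using that len by (intro nth_mem) simp
        then show ?thesis
          using a that by (auto simp: S_def H_def intro!: generate.incl)
      qed
      show "T = carrier SL2" if T: "subgroup T SL2" "- mat 1 \<in> T" "\<And>i. i < 4 \<Longrightarrow> a i \<in> T" for T
      proof -
        have "set s \<subseteq> \<phi> ` T"
        proof
          fix x assume "x \<in> set s"
          then obtain i where i: "i < 4" "x = s ! i"
            using len by (auto simp: in_set_conv_nth)
          then have "x = \<phi> (a i)"
            using a(2) by simp
          then show "x \<in> \<phi> ` T"
            using T(3)[OF i(1)] by blast
        qed
        then have "generate G (set s) \<subseteq> \<phi> ` T"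
          by (rule G.generate_subgroup_incl[OF _ \<phi>.subgroup_img_is_subgroup[OF T(1)]])
        \<comment> \<open>The image of \<open>T\<close> is the whole quotient. Since
          \<open>T\<close> contains \<open>- mat 1\<close>, it is the full preimage of its
          image.\<close>
        then have sub: "\<phi> ` carrier SL2 \<subseteq> \<phi> ` T"
          using s(2) onto by simp
        have "M \<in> T" if M: "M \<in> carrier SL2" for M
        proof -
          obtain N where "N \<in> T" "\<phi> M = \<phi> N"
            using sub M by blast
          then show ?thesis
            using minus_mult_closed[OF T(1,2)] by (auto simp: \<phi> doubleton_eq_iff)
        qed
        then show ?thesis
          using subgroup.subset[OF T(1)] by blast
      qed
    qed
    then show False
      using A g1 by (auto simp: \<phi> one_G)
  qed
qed

end
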